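(* Let $\kappa=(\kappa_1,\kappa_2)$ with $\kappa_1,\kappa_2>0$. For all $x=(x_1,x_2),\,y=(y_1,y_2)\in\mathbb{R}^2$, the generalized Bessel function $J^{\kappa}_{B_2}$ of type $B_2$ with multiplicity $\kappa$ (normalized so that $J^\kappa_{B_2}(0,y)=1$) satisfies $$J_{B_2}^{\kappa}(x,y)=c_\kappa\int_{-1}^1\int_{-1}^1 \mathcal{I}_{\mu-1}\left(\sqrt{\frac{Z_{x,y}(u,v)}{2}}\right)(1-u^2)^{\kappa_2-1}(1-v^2)^{\kappa_1-1}\,du\,dv,$$ where $\mu=\kappa_1+\kappa_2+\tfrac12$, $$Z_{x,y}(u,v)=(x_1^2+x_2^2)(y_1^2+y_2^2)+u\,(x_1^2-x_2^2)(y_1^2-y_2^2)+4v\,x_1x_2y_1y_2,$$ and $$c_\kappa=\frac{\Gamma(\kappa_1+1/2)\,\Gamma(\kappa_2+1/2)}{\pi\,\Gamma(\kappa_1)\,\Gamma(\kappa_2)}.$$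
   Context: The normalized modified Bessel function of the first kind is $$\mathcal{I}_{\nu}(t)=\Gamma(\nu+1)\sum_{m=0}^\infty\frac{(t/2)^{2m}}{m!\,\Gamma(m+\nu+1)}.$$ The root system of type $B_2$ is $R=\{\pm e_1,\pm e_2,\pm e_1\pm e_2\}\subset\mathbb{R}^2$, with Weyl group $W_B$ of order $8$ (generated by sign changes and exchange of coordinates). The multiplicity $\kappa=(\kappa_1,\kappa_2)$ takes the value $\kappa_1$ on $\pm e_i$ and $\kappa_2$ on $\pm e_1\pm e_2$. The Dunkl operators of type $B_2$ are $$T_1^\kappa f(x)=\frac{\partial f}{\partial x_1}(x)+\kappa_1\frac{f(x_1,x_2)-f(-x_1,x_2)}{x_1}+\kappa_2\frac{f(x_1,x_2)-f(x_2,x_1)}{x_1-x_2}+\kappa_2\frac{f(x_1,x_2)-f(-x_2,-x_1)}{x_1+x_2},$$ $$T_2^\kappa f(x)=\frac{\partial f}{\partial x_2}(x)+\kappa_1\frac{f(x_1,x_2)-f(x_1,-x_2)}{x_2}-\kappa_2\frac{f(x_1,x_2)-f(x_2,x_1)}{x_1-x_2}+\kappa_2\frac{f(x_1,x_2)-f(-x_2,-x_1)}{x_1+x_2}.$$ For $y\in\mathbb{R}^2$ the Dunkl kernel $E^\kappa_{B_2}(\cdot,y)$ is the unique (real-analytic) solution $f$ on $\mathbb{R}^2$ of $T_i^\kappa f=y_i f$ for $i=1,2$, with $f(0)=1$. The generalized Bessel function is $$J^\kappa_{B_2}(x,y)=\frac{1}{|W_B|}\sum_{w\in W_B}E^\kappa_{B_2}(w.x,y).$$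 *)

theory Defs
  imports "HOL-Analysis.Analysis"
begin

definition bessel_I_norm :: "real \<Rightarrow> real \<Rightarrow> real" where
  "bessel_I_norm \<nu> t =
     Gamma (\<nu> + 1) * (\<Sum>m. (t / 2) ^ (2 * m) / (fact m * Gamma (real m + \<nu> + 1)))"

inductive_set weyl_B2 :: "(real \<times> real \<Rightarrow> real \<times> real) set" where
  weyl_id: "(\<lambda>x. x) \<in> weyl_B2"
| weyl_sign1: "w \<in> weyl_B2 \<Longrightarrow> (\<lambda>x. (- fst (w x), snd (w x))) \<in> weyl_B2"
| weyl_sign2: "w \<in> weyl_B2 \<Longrightarrow> (\<lambda>x. (fst (w x), - snd (w x))) \<in> weyl_B2"
| weyl_swap: "w \<in> weyl_B2 \<Longrightarrow> (\<lambda>x. (snd (w x), fst (w x))) \<in> weyl_B2"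

text \<open>The difference quotients in the Dunkl operators have removable singularities on the
  reflecting lines when the function is smooth. On such a line the quotient denotes its
  continuous extension, not the value forced by division by zero being zero.\<close>

definition ext_quot :: "(real \<times> real \<Rightarrow> real) \<Rightarrow> (real \<times> real \<Rightarrow> real) \<Rightarrow> real \<times> real \<Rightarrow> real" where
  "ext_quot g d x =
     (if d x = 0 then Lim (at x within {z. d z \<noteq> 0}) (\<lambda>z. g z / d z) else g x / d x)"

definition dunkl_T1 :: "real \<Rightarrow> real \<Rightarrow> (real \<times> real \<Rightarrow> real) \<Rightarrow> real \<times> real \<Rightarrow> real" where
  "dunkl_T1 \<kappa>1 \<kappa>2 f x =
     deriv (\<lambda>t. f (t, snd x)) (fst x)
     + \<kappa>1 * ext_quot (\<lambda>z. f z - f (- fst z, snd z)) (\<lambda>z. fst z) x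
     + \<kappa>2 * ext_quot (\<lambda>z. f z - f (snd z, fst z)) (\<lambda>z. fst z - snd z) x
     + \<kappa>2 * ext_quot (\<lambda>z. f z - f (- snd z, - fst z)) (\<lambda>z. fst z + snd z) x"

definition dunkl_T2 :: "real \<Rightarrow> real \<Rightarrow> (real \<times> real \<Rightarrow> real) \<Rightarrow> real \<times> real \<Rightarrow> real" where
  "dunkl_T2 \<kappa>1 \<kappa>2 f x =
     deriv (\<lambda>t. f (fst x, t)) (snd x)
     + \<kappa>1 * ext_quot (\<lambda>z. f z - f (fst z, - snd z)) (\<lambda>z. snd z) x
     - \<kappa>2 * ext_quot (\<lambda>z. f z - f (snd z, fst z)) (\<lambda>z. fst z - snd z) x
     + \<kappa>2 * ext_quot (\<lambda>z. f z - f (- snd z, - fst z)) (\<lambda>z. fst z + snd z) x"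

definition real_analytic2 :: "(real \<times> real \<Rightarrow> real) \<Rightarrow> bool" where
  "real_analytic2 f \<longleftrightarrow>
     (\<forall>a b. \<exists>(c :: nat \<Rightarrow> nat \<Rightarrow> real) r. r > 0 \<and>
        (\<forall>h k. \<bar>h\<bar> < r \<and> \<bar>k\<bar> < r \<longrightarrow>
           ((\<lambda>(m, n). c m n * h ^ m * k ^ n) has_sum f (a + h, b + k)) UNIV))"

definition is_dunkl_kernel ::
  "real \<Rightarrow> real \<Rightarrow> real \<times> real \<Rightarrow> (real \<times> real \<Rightarrow> real) \<Rightarrow> bool" where
  "is_dunkl_kernel \<kappa>1 \<kappa>2 y f \<longleftrightarrow>
     real_analytic2 f \<and>
     (\<forall>x. dunkl_T1 \<kappa>1 \<kappa>2 f x = fst y * f x) \<and>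
     (\<forall>x. dunkl_T2 \<kappa>1 \<kappa>2 f x = snd y * f x) \<and>
     f (0, 0) = 1"

definition dunkl_kernel :: "real \<Rightarrow> real \<Rightarrow> real \<times> real \<Rightarrow> real \<times> real \<Rightarrow> real" where
  "dunkl_kernel \<kappa>1 \<kappa>2 x y = (THE f. is_dunkl_kernel \<kappa>1 \<kappa>2 y f) x"

definition gen_bessel_B2 :: "real \<Rightarrow> real \<Rightarrow> real \<times> real \<Rightarrow> real \<times> real \<Rightarrow> real" where
  "gen_bessel_B2 \<kappa>1 \<kappa>2 x y =
     1 / real (card weyl_B2) * (\<Sum>w\<in>weyl_B2. dunkl_kernel \<kappa>1 \<kappa>2 (w x) y)"

definition Z_B2 :: "real \<times> real \<Rightarrow> real \<times> real \<Rightarrow> real \<Rightarrow> real \<Rightarrow> real" where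
  "Z_B2 x y u v =
     ((fst x)\<^sup>2 + (snd x)\<^sup>2) * ((fst y)\<^sup>2 + (snd y)\<^sup>2)
     + u * ((fst x)\<^sup>2 - (snd x)\<^sup>2) * ((fst y)\<^sup>2 - (snd y)\<^sup>2)
     + 4 * v * fst x * snd x * fst y * snd y"

definition c_B2 :: "real \<Rightarrow> real \<Rightarrow> real" where
  "c_B2 \<kappa>1 \<kappa>2 =
     Gamma (\<kappa>1 + 1 / 2) * Gamma (\<kappa>2 + 1 / 2) / (pi * Gamma \<kappa>1 * Gamma \<kappa>2)"

end

theory Submission
  imports Defs
begin

text \<open>
  Write \<open>\<mu> = \<kappa>1 + \<kappa>2 + 1/2\<close>, let \<open>Z\<close> be the form in the integrand, and let \<open>dm\<close> be the product of the two
  Gegenbauer weights \<open>(1 - u\<^sup>2) powr (\<kappa>2 - 1)\<close> and \<open>(1 - v\<^sup>2) powr (\<kappa>1 - 1)\<close> on the square. The whole Dunkl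
  kernel, and not only its average, has a double integral representation:

    \<open>E(x) = c \<integral>\<integral> (I\<^bsub>\<mu>-1\<^esub>(sqrt(Z/2)) + (\<langle>x, y\<rangle> / (2 \<mu>)) I\<^bsub>\<mu>\<^esub>(sqrt(Z/2))) (1 + u) (1 + v) dm\<close>.

  Averaging it over the Weyl group gives the theorem: the second term is odd in \<open>x\<close> and disappears, and
  since a sign change of one coordinate of \<open>x\<close> turns \<open>v\<close> into \<open>- v\<close> in \<open>Z\<close>, and the exchange of the
  coordinates turns \<open>u\<close> into \<open>- u\<close>, the weight \<open>(1 + u) (1 + v)\<close> averages to \<open>1\<close>.

  That \<open>E\<close> solves the Dunkl system rests on three facts. First, because reflections of \<open>x\<close> act as reflections
  of \<open>u\<close> and \<open>v\<close>, integration by parts against the Gegenbauer weight converts each reflection difference into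
  an integral of a derivative of the integrand
  (\<open>integral_gegenbauer_reflection_difference\<close>); it thus has the same shape as the
  term coming from the partial derivative. Summing all terms, the first Dunkl operator turns the even part into an integral
  against \<open>4 y1 \<langle>x, y\<rangle>\<close>, which is \<open>y1\<close> times the odd part. Second, the Bessel functions satisfy a three-term
  recurrence in the order (\<open>bessel_Phi_recurrence\<close>), which is what makes the odd part return to the even
  part. Third, \<open>2 \<langle>x, y\<rangle>\<^sup>2\<close> is the value of \<open>Z\<close> at \<open>u = v = 1\<close>. The remaining computation is the polynomial
  identity \<open>dunkl_kernel_algebra\<close>.

  The kernel is specified as the unique real-analytic solution, so analyticity and
  uniqueness are needed too. Analyticity: \<open>Z\<close> is a quadratic form in \<open>x\<close> with bounded coefficients and the Bessel
  series is dominated by the exponential series, so \<open>E\<close> is an everywhere convergent double power series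
  (\<open>entire2_gegenbauer2_power_series\<close>), which can be recentred at any point. Uniqueness: the combination
  \<open>x1 T1 + x2 T2\<close> is the Euler operator plus a sum of multiples of \<open>1 - reflection\<close>, a positive semidefinite
  operator; an energy estimate along rays then shows that a solution that vanishes at the origin vanishes
  (\<open>euler_reflection_equation_zero\<close>).
\<close>

section \<open>Everywhere convergent double power series\<close>

text \<open>Equality with a series on the whole plane, in the sense of unconditional sums: this forces absolute
  convergence everywhere, which is what makes regrouping and recentring legitimate.\<close>

definition entire2 :: "(real \<times> real \<Rightarrow> real) \<Rightarrow> bool" where
  "entire2 f \<longleftrightarrow> (\<exists>c :: nat \<Rightarrow> nat \<Rightarrow> real. \<forall>a b.
     ((\<lambda>(m, n). c m n * a ^ m * b ^ n) has_sum f (a, b)) UNIV)"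

text \<open>An unconditionally summable family of monomials may repeat exponents; collecting the fibres of the
  exponent map gives one coefficient for each monomial. All later closure properties are obtained by exhibiting such a family.\<close>

lemma entire2_monomial_family:
  fixes \<alpha> :: "'i \<Rightarrow> real"
  assumes s: "\<And>a b. ((\<lambda>s. \<alpha> s * a ^ d s * b ^ e s) has_sum f (a, b)) S"
  shows "entire2 f"
  unfolding entire2_def
proof (intro exI allI)
  fix a b :: real
  define F where "F = (\<lambda>p :: nat \<times> nat. {s \<in> S. d s = fst p \<and> e s = snd p})"
  have "(\<alpha> has_sum f (1, 1)) S" using s[of 1 1] by simp
  then have "\<alpha> summable_on S" by (rule has_sum_imp_summable)
  then have F: "(\<alpha> has_sum infsum \<alpha> (F p)) (F p)" for p
    by (intro has_sum_infsum summable_on_subset_banach[of \<alpha> S "F p"]) (auto simp: F_def)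
  have "((\<lambda>(p, s). \<alpha> s * a ^ fst p * b ^ snd p) has_sum f (a, b)) ((\<lambda>s. ((d s, e s), s)) ` S)"
    by (subst has_sum_reindex) (use s[of a b] in \<open>auto simp: inj_on_def o_def\<close>)
  also have "(\<lambda>s. ((d s, e s), s)) ` S = Sigma UNIV F" by (auto simp: F_def)
  finally have "((\<lambda>p. infsum \<alpha> (F p) * a ^ fst p * b ^ snd p) has_sum f (a, b)) UNIV"
    by (rule has_sum_SigmaD) (auto intro!: has_sum_cmult_left F)
  then show "((\<lambda>(m, n). infsum \<alpha> (F (m, n)) * a ^ m * b ^ n) has_sum f (a, b)) UNIV"
    by (simp add: case_prod_unfold)
qed

lemma entire2_add:
  assumes "entire2 f" "entire2 g"
  shows "entire2 (\<lambda>x. f x + g x)"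
proof -
  from assms obtain c d where
    "\<And>a b. ((\<lambda>(m, n). c m n * a ^ m * b ^ n) has_sum f (a, b)) UNIV"
    "\<And>a b. ((\<lambda>(m, n). d m n * a ^ m * b ^ n) has_sum g (a, b)) UNIV"
    unfolding entire2_def by blast
  from has_sum_add[OF this] show ?thesis
    unfolding entire2_def by (intro exI[of _ "\<lambda>m n. c m n + d m n"]) (simp add: case_prod_unfold algebra_simps)
qed

lemma entire2_cmult:
  assumes "entire2 f"
  shows "entire2 (\<lambda>x. k * f x)"
proof -
  from assms obtain c where
    "\<And>a b. ((\<lambda>(m, n). c m n * a ^ m * b ^ n) has_sum f (a, b)) UNIV"
    unfolding entire2_def by blast
  from has_sum_cmult_right[OF this, of k] show ?thesis
    unfolding entire2_def by (intro exI[of _ "\<lambda>m n. k * c m n"]) (simp add: case_prod_unfold algebra_simps)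
qed

lemma entire2_mult_coordinate:
  assumes "entire2 f"
  shows "entire2 (\<lambda>x. fst x * f x)" "entire2 (\<lambda>x. snd x * f x)"
proof -
  from assms obtain c where c:
    "\<And>a b. ((\<lambda>(m, n). c m n * a ^ m * b ^ n) has_sum f (a, b)) UNIV"
    unfolding entire2_def by blast
  show "entire2 (\<lambda>x. fst x * f x)"
    by (rule entire2_monomial_family[where \<alpha>="\<lambda>(m, n). c m n" and d="\<lambda>(m, n). Suc m"
          and e="\<lambda>(m, n). n" and S=UNIV])
      (use has_sum_cmult_right[OF c] in \<open>simp add: case_prod_unfold algebra_simps\<close>)
  show "entire2 (\<lambda>x. snd x * f x)"
    by (rule entire2_monomial_family[where \<alpha>="\<lambda>(m, n). c m n" and d="\<lambda>(m, n). m"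
          and e="\<lambda>(m, n). Suc n" and S=UNIV])
      (use has_sum_cmult_right[OF c] in \<open>simp add: case_prod_unfold algebra_simps\<close>)
qed

text \<open>Expand each monomial by the binomial theorem. The resulting family is summable because its absolute
  values sum to the given series with absolute values, evaluated at \<open>(\<bar>a0\<bar> + \<bar>h\<bar>, \<bar>b0\<bar> + \<bar>k\<bar>)\<close>.\<close>

lemma entire2_translate:
  assumes "entire2 f"
  shows "entire2 (\<lambda>x. f (a0 + fst x, b0 + snd x))"
proof -
  from assms obtain c where c:
    "\<And>a b. ((\<lambda>(m, n). c m n * a ^ m * b ^ n) has_sum f (a, b)) UNIV"
    unfolding entire2_def by blast
  define S :: "((nat \<times> nat) \<times> nat \<times> nat) set" where "S = Sigma UNIV (\<lambda>(m, n). {..m} \<times> {..n})"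
  define \<alpha> where "\<alpha> = (\<lambda>((m, n), (i, j)).
     c m n * (real (m choose i) * a0 ^ (m - i)) * (real (n choose j) * b0 ^ (n - j)))"
  have bin: "(\<Sum>(i, j)\<in>{..m} \<times> {..n}. C * (real (m choose i) * A ^ (m - i)) * (real (n choose j) * B ^ (n - j)) * h ^ i * k ^ j)
     = C * (A + h) ^ m * (B + k) ^ n" for C A B h k :: real and m n
  proof -
    have "(\<Sum>(i, j)\<in>{..m} \<times> {..n}. C * (real (m choose i) * A ^ (m - i)) * (real (n choose j) * B ^ (n - j)) * h ^ i * k ^ j)
      = C * (\<Sum>(i, j)\<in>{..m} \<times> {..n}. (real (m choose i) * h ^ i * A ^ (m - i)) * (real (n choose j) * k ^ j * B ^ (n - j)))"
      unfolding sum_distrib_left by (intro sum.cong refl) (auto simp: mult_ac)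
    also have "\<dots> = C * ((\<Sum>i\<le>m. real (m choose i) * h ^ i * A ^ (m - i)) * (\<Sum>j\<le>n. real (n choose j) * k ^ j * B ^ (n - j)))"
      by (simp only: sum_product sum.cartesian_product)
    also have "\<dots> = C * ((h + A) ^ m * (k + B) ^ n)"
      by (simp only: binomial_ring)
    finally show ?thesis by (simp add: add.commute mult.assoc)
  qed
  show ?thesis
  proof (rule entire2_monomial_family[where \<alpha>=\<alpha> and d="\<lambda>s. fst (snd s)" and e="\<lambda>s. snd (snd s)" and S=S])
    fix h k :: real
    have "(\<lambda>s. norm (\<alpha> s * h ^ fst (snd s) * k ^ snd (snd s))) summable_on S"
      unfolding S_def
    proof (rule summable_on_SigmaI)
      have "(\<lambda>(m, n). c m n * (\<bar>a0\<bar> + \<bar>h\<bar>) ^ m * (\<bar>b0\<bar> + \<bar>k\<bar>) ^ n) summable_on UNIV"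
        by (rule has_sum_imp_summable[OF c])
      then show "(\<lambda>(m, n). \<bar>c m n\<bar> * (\<bar>a0\<bar> + \<bar>h\<bar>) ^ m * (\<bar>b0\<bar> + \<bar>k\<bar>) ^ n) summable_on UNIV"
        by (subst (asm) summable_on_iff_abs_summable_on_real) (simp add: case_prod_unfold abs_mult power_abs)
      fix p :: "nat \<times> nat"
      obtain m n where p: "p = (m, n)" by (cases p)
      show "((\<lambda>y. norm (\<alpha> (p, y) * h ^ fst (snd (p, y)) * k ^ snd (snd (p, y)))) has_sum
          (case p of (m, n) \<Rightarrow> \<bar>c m n\<bar> * (\<bar>a0\<bar> + \<bar>h\<bar>) ^ m * (\<bar>b0\<bar> + \<bar>k\<bar>) ^ n)) (case p of (m, n) \<Rightarrow> {..m} \<times> {..n})"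
        unfolding p prod.case
        by (rule has_sum_finiteI, simp, subst bin [symmetric])
          (auto intro!: sum.cong simp: \<alpha>_def abs_mult power_abs)
    qed simp
    then have "(\<lambda>s. \<alpha> s * h ^ fst (snd s) * k ^ snd (snd s)) summable_on S"
      by (subst summable_on_iff_abs_summable_on_real)
    then show "((\<lambda>s. \<alpha> s * h ^ fst (snd s) * k ^ snd (snd s)) has_sum f (a0 + fst (h, k), b0 + snd (h, k))) S"
      unfolding S_def
    proof (rule has_sum_SigmaI[rotated 2])
      show "((\<lambda>(m, n). c m n * (a0 + h) ^ m * (b0 + k) ^ n) has_sum f (a0 + fst (h, k), b0 + snd (h, k))) UNIV"
        using c by simp
      fix p :: "nat \<times> nat"
      obtain m n where p: "p = (m, n)" by (cases p)
      show "((\<lambda>y. \<alpha> (p, y) * h ^ fst (snd (p, y)) * k ^ snd (snd (p, y))) has_sum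
          (case p of (m, n) \<Rightarrow> c m n * (a0 + h) ^ m * (b0 + k) ^ n)) (case p of (m, n) \<Rightarrow> {..m} \<times> {..n})"
        unfolding p prod.case
        by (rule has_sum_finiteI, simp, subst bin [symmetric]) (auto intro!: sum.cong simp: \<alpha>_def)
    qed
  qed
qed

lemma entire2_imp_real_analytic2:
  assumes "entire2 f"
  shows "real_analytic2 f"
  unfolding real_analytic2_def
proof (intro allI)
  fix a b
  obtain c where "\<forall>h k. ((\<lambda>(m, n). c m n * h ^ m * k ^ n) has_sum f (a + h, b + k)) UNIV"
    using entire2_translate[OF assms, of a b] unfolding entire2_def by auto
  then show "\<exists>c r. r > 0 \<and> (\<forall>h k. \<bar>h\<bar> < r \<and> \<bar>k\<bar> < r \<longrightarrow>
           ((\<lambda>(m, n). c m n * h ^ m * k ^ n) has_sum f (a + h, b + k)) UNIV)"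
    by (intro exI[of _ c] exI[of _ 1]) simp
qed

text \<open>The terms of total degree at least two contribute at most a constant times the squared distance, by
  comparison with the series at a fixed smaller radius.\<close>

lemma real_analytic2_imp_differentiable:
  assumes "real_analytic2 f"
  shows "f differentiable (at x)"
proof -
  obtain a b where x: "x = (a, b)" by (cases x)
  obtain c r where r: "r > 0" and
    "\<forall>h k. \<bar>h\<bar> < r \<and> \<bar>k\<bar> < r \<longrightarrow> ((\<lambda>(m, n). c m n * h ^ m * k ^ n) has_sum f (a + h, b + k)) UNIV"
    using assms[unfolded real_analytic2_def, rule_format, of a b] by (elim exE conjE) (rule that)
  then have c: "((\<lambda>(m, n). c m n * h ^ m * k ^ n) has_sum f (a + h, b + k)) UNIV"
    if "\<bar>h\<bar> < r" "\<bar>k\<bar> < r" for h k using that by blast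
  \<comment> \<open>a radius at which the series converges absolutely\<close>
  define \<rho> where "\<rho> = r / 2"
  have \<rho>: "0 < \<rho>" "\<rho> < r" using r by (auto simp: \<rho>_def)
  have "(\<lambda>(m, n). c m n * \<rho> ^ m * \<rho> ^ n) summable_on UNIV"
    by (rule has_sum_imp_summable[OF c]) (use \<rho> in auto)
  then have "(\<lambda>(m, n). \<bar>c m n\<bar> * \<rho> ^ (m + n)) summable_on UNIV"
    by (subst (asm) summable_on_iff_abs_summable_on_real)
      (use \<rho> in \<open>simp add: case_prod_unfold abs_mult power_abs power_add mult.assoc\<close>)
  define U :: "(nat \<times> nat) set" where "U = UNIV - {(0,0), (1,0), (0,1)}"
  have sU: "(\<lambda>(m, n). \<bar>c m n\<bar> * \<rho> ^ (m + n)) summable_on U"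
    by (rule summable_on_subset_banach) (fact | simp)+
  define M where "M = infsum (\<lambda>(m, n). \<bar>c m n\<bar> * \<rho> ^ (m + n)) U"
  have M: "((\<lambda>(m, n). \<bar>c m n\<bar> * \<rho> ^ (m + n)) has_sum M) U"
    unfolding M_def by (rule has_sum_infsum) fact
  have f0: "f (a, b) = c 0 0"
  proof -
    have "((\<lambda>(m, n). c m n * 0 ^ m * 0 ^ n) has_sum c 0 0) {(0, 0)}"
      by (rule has_sum_finiteI) auto
    also have "?this \<longleftrightarrow> ((\<lambda>(m, n). c m n * 0 ^ m * 0 ^ n) has_sum c 0 0) UNIV"
      by (rule has_sum_cong_neutral) (auto simp: zero_power)
    finally show ?thesis using c[of 0 0] r has_sum_unique by fastforce
  qed
  have bound: "\<bar>f (a + h, b + k) - f (a, b) - (c 1 0 * h + c 0 1 * k)\<bar> \<le> M / \<rho>\<^sup>2 * s\<^sup>2"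
    if s: "\<bar>h\<bar> \<le> s" "\<bar>k\<bar> \<le> s" "s < \<rho>" for h k s
  proof -
    have s0: "0 \<le> s" using s by linarith
    let ?t = "\<lambda>(m, n). c m n * h ^ m * k ^ n"
    have "(?t has_sum (f (a + h, b + k) - sum ?t {(0,0), (1,0), (0,1)})) U"
      unfolding U_def by (intro has_sum_Diff has_sum_finite) (use s \<rho> in \<open>auto intro!: c\<close>)
    then have t: "(?t has_sum (f (a + h, b + k) - f (a, b) - (c 1 0 * h + c 0 1 * k))) U"
      by (simp add: f0 algebra_simps)
    have t': "((\<lambda>p. - ?t p) has_sum - (f (a + h, b + k) - f (a, b) - (c 1 0 * h + c 0 1 * k))) U"
      using has_sum_cmult_right[OF t, of "-1"] by (simp only: mult_minus1)
    have M': "((\<lambda>(m, n). \<bar>c m n\<bar> * \<rho> ^ (m + n) * (s\<^sup>2 / \<rho>\<^sup>2)) has_sum M * (s\<^sup>2 / \<rho>\<^sup>2)) U"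
      using has_sum_cmult_left[OF M, of "s\<^sup>2 / \<rho>\<^sup>2"] by (simp only: case_prod_unfold)
    have le: "\<bar>?t p\<bar> \<le> (case p of (m, n) \<Rightarrow> \<bar>c m n\<bar> * \<rho> ^ (m + n) * (s\<^sup>2 / \<rho>\<^sup>2))" if p: "p \<in> U" for p
    proof -
      obtain m n where mn: "p = (m, n)" by (cases p)
      \<comment> \<open>only terms of degree at least two are left, so two factors of \<open>s / \<rho>\<close> can be extracted\<close>
      have "2 \<le> m + n" using p by (cases m; cases n) (auto simp: U_def mn)
      then have "(s / \<rho>) ^ (m + n) \<le> (s / \<rho>)\<^sup>2"
        using s s0 \<rho> by (intro power_decreasing) auto
      then have "s ^ (m + n) \<le> \<rho> ^ (m + n) * (s\<^sup>2 / \<rho>\<^sup>2)"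
        using \<rho> by (simp add: power_divide field_simps)
      moreover have "\<bar>h\<bar> ^ m * \<bar>k\<bar> ^ n \<le> s ^ m * s ^ n"
        using s s0 by (intro mult_mono power_mono) auto
      ultimately have "\<bar>h\<bar> ^ m * \<bar>k\<bar> ^ n \<le> \<rho> ^ (m + n) * (s\<^sup>2 / \<rho>\<^sup>2)"
        by (simp add: power_add)
      from mult_left_mono[OF this, of "\<bar>c m n\<bar>"] show ?thesis
        by (simp add: mn abs_mult power_abs mult.assoc)
    qed
    have "f (a + h, b + k) - f (a, b) - (c 1 0 * h + c 0 1 * k) \<le> M * (s\<^sup>2 / \<rho>\<^sup>2)"
      by (rule has_sum_mono[OF t M']) (rule abs_le_D1[OF le])
    moreover have "- (f (a + h, b + k) - f (a, b) - (c 1 0 * h + c 0 1 * k)) \<le> M * (s\<^sup>2 / \<rho>\<^sup>2)"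
      by (rule has_sum_mono[OF t' M']) (rule abs_le_D2[OF le])
    ultimately show ?thesis using \<rho> by (simp add: abs_le_iff field_simps)
  qed
  have "(f has_derivative (\<lambda>h. c 1 0 * fst h + c 0 1 * snd h)) (at x within UNIV)"
  proof (rule has_derivativeI_sandwich[OF \<rho>(1)])
    show "bounded_linear (\<lambda>h::real \<times> real. c 1 0 * fst h + c 0 1 * snd h)"
      by (intro bounded_linear_intros)
    show "((\<lambda>z. M / \<rho>\<^sup>2 * norm (z - x)) \<longlongrightarrow> 0) (at x within UNIV)"
      using \<rho> by (auto intro!: tendsto_eq_intros)
    fix z assume z: "z \<noteq> x" "dist z x < \<rho>"
    have n: "norm (z - x) > 0" using z by simp
    have "\<bar>f z - f x - (c 1 0 * fst (z - x) + c 0 1 * snd (z - x))\<bar> \<le> M / \<rho>\<^sup>2 * (norm (z - x))\<^sup>2"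
      using bound[of "fst (z - x)" "norm (z - x)" "snd (z - x)"] z
        norm_fst_le[of "fst (z - x)" "snd (z - x)"] norm_snd_le[of "snd (z - x)" "fst (z - x)"]
      unfolding prod.collapse by (simp add: x dist_norm)
    with n show "norm (f z - f x - (c 1 0 * fst (z - x) + c 0 1 * snd (z - x))) / norm (z - x)
        \<le> M / \<rho>\<^sup>2 * norm (z - x)"
      by (simp add: divide_le_eq power2_eq_square mult.assoc)
  qed
  then show ?thesis unfolding differentiable_def by auto
qed

text \<open>The Dunkl operators are written with partial derivatives along the axes, whereas the uniqueness argument
  differentiates along rays; joint differentiability connects the two.\<close>

lemma real_analytic2_has_derivative:
  assumes "real_analytic2 f"
  shows "(f has_derivative (\<lambda>h. fst h * deriv (\<lambda>t. f (t, snd x)) (fst x)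
                              + snd h * deriv (\<lambda>t. f (fst x, t)) (snd x))) (at x)"
proof -
  obtain D where D: "(f has_derivative D) (at x)"
    using real_analytic2_imp_differentiable[OF assms] unfolding differentiable_def by blast
  interpret D: bounded_linear D using D by (rule has_derivative_bounded_linear)
  have "((\<lambda>t. f (t, snd x)) has_derivative (\<lambda>t. D (t, 0))) (at (fst x))"
    by (rule has_derivative_compose[where g=f and g'=D and f="\<lambda>t. (t, snd x)" and f'="\<lambda>t. (t, 0)"])
      (auto intro!: has_derivative_Pair D)
  also have "(\<lambda>t. D (t, 0)) = (*) (D (1, 0))"
  proof
    fix t show "D (t, 0) = D (1, 0) * t" using D.scaleR[of t "(1, 0)"] by (simp add: mult.commute)
  qed
  finally have d1: "deriv (\<lambda>t. f (t, snd x)) (fst x) = D (1, 0)"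
    by (intro DERIV_imp_deriv) (simp only: has_field_derivative_def)
  have "((\<lambda>t. f (fst x, t)) has_derivative (\<lambda>t. D (0, t))) (at (snd x))"
    by (rule has_derivative_compose[where g=f and g'=D and f="\<lambda>t. (fst x, t)" and f'="\<lambda>t. (0, t)"])
      (auto intro!: has_derivative_Pair D)
  also have "(\<lambda>t. D (0, t)) = (*) (D (0, 1))"
  proof
    fix t show "D (0, t) = D (0, 1) * t" using D.scaleR[of t "(0, 1)"] by (simp add: mult.commute)
  qed
  finally have d2: "deriv (\<lambda>t. f (fst x, t)) (snd x) = D (0, 1)"
    by (intro DERIV_imp_deriv) (simp only: has_field_derivative_def)
  have "D h = fst h * D (1, 0) + snd h * D (0, 1)" for h
    using D.add[of "fst h *\<^sub>R (1, 0)" "snd h *\<^sub>R (0, 1)"]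
      D.scaleR[of "fst h" "(1, 0)"] D.scaleR[of "snd h" "(0, 1)"] by simp
  then have "D = (\<lambda>h. fst h * D (1, 0) + snd h * D (0, 1))" by (rule ext)
  then show ?thesis using D unfolding d1 d2 by (simp only:)
qed

lemma real_analytic2_isCont: "real_analytic2 f \<Longrightarrow> isCont f x"
  by (rule has_derivative_continuous[OF real_analytic2_has_derivative])

section \<open>Uniqueness of the Dunkl kernel\<close>

text \<open>Multiplying by the linear form removes the quotient, on the mirror as well as off it, so no limit has to
  be evaluated for the uniqueness argument.\<close>

lemma ext_quot_mult: "(d x = 0 \<Longrightarrow> g x = 0) \<Longrightarrow> d x * ext_quot g d x = g x"
  by (simp add: ext_quot_def)

text \<open>In \<open>x1 T1 + x2 T2\<close> the linear forms in the denominators cancel: the two coefficients of a difference along a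
  diagonal mirror combine to exactly that linear form.\<close>

lemma dunkl_euler_identity:
  "a * dunkl_T1 \<kappa>1 \<kappa>2 f (a, b) + b * dunkl_T2 \<kappa>1 \<kappa>2 f (a, b) =
     a * deriv (\<lambda>t. f (t, b)) a + b * deriv (\<lambda>t. f (a, t)) b
     + \<kappa>1 * (f (a, b) - f (- a, b)) + \<kappa>1 * (f (a, b) - f (a, - b))
     + \<kappa>2 * (f (a, b) - f (b, a)) + \<kappa>2 * (f (a, b) - f (- b, - a))"
proof -
  define q1 q2 q3 q4 where
    "q1 = ext_quot (\<lambda>z. f z - f (- fst z, snd z)) (\<lambda>z. fst z) (a, b)" and
    "q2 = ext_quot (\<lambda>z. f z - f (fst z, - snd z)) (\<lambda>z. snd z) (a, b)" and
    "q3 = ext_quot (\<lambda>z. f z - f (snd z, fst z)) (\<lambda>z. fst z - snd z) (a, b)" and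
    "q4 = ext_quot (\<lambda>z. f z - f (- snd z, - fst z)) (\<lambda>z. fst z + snd z) (a, b)"
  have q: "a * q1 = f (a, b) - f (- a, b)" "b * q2 = f (a, b) - f (a, - b)"
    "(a - b) * q3 = f (a, b) - f (b, a)" "(a + b) * q4 = f (a, b) - f (- b, - a)"
    unfolding q1_def q2_def q3_def q4_def
    using ext_quot_mult[of "\<lambda>z. fst z" "(a, b)" "\<lambda>z. f z - f (- fst z, snd z)"]
      ext_quot_mult[of "\<lambda>z. snd z" "(a, b)" "\<lambda>z. f z - f (fst z, - snd z)"]
      ext_quot_mult[of "\<lambda>z. fst z - snd z" "(a, b)" "\<lambda>z. f z - f (snd z, fst z)"]
      ext_quot_mult[of "\<lambda>z. fst z + snd z" "(a, b)" "\<lambda>z. f z - f (- snd z, - fst z)"]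
    by (auto simp: add_eq_0_iff)
  show ?thesis
    unfolding dunkl_T1_def dunkl_T2_def fst_conv snd_conv q [symmetric]
    unfolding q1_def [symmetric] q2_def [symmetric] q3_def [symmetric] q4_def [symmetric]
    by (simp add: algebra_simps)
qed

text \<open>The operator \<open>\<Sum> \<kappa> (1 - s)\<close> over the reflections \<open>s\<close>, acting on the eight values of a function on one orbit,
  has a quadratic form that is a sum of squares of differences. The values \<open>p1, ..., p4\<close> are those at
  \<open>(\<plusminus>a, \<plusminus>b)\<close> and \<open>q1, ..., q4\<close> those at \<open>(\<plusminus>b, \<plusminus>a)\<close>.\<close>

lemma reflection_form_nonneg:
  fixes p1 p2 p3 p4 q1 q2 q3 q4 \<kappa>1 \<kappa>2 :: real
  assumes "\<kappa>1 \<ge> 0" "\<kappa>2 \<ge> 0"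
  shows "0 \<le>
     p1 * (\<kappa>1 * (p1 - p2) + \<kappa>1 * (p1 - p3) + \<kappa>2 * (p1 - q1) + \<kappa>2 * (p1 - q4))
   + p2 * (\<kappa>1 * (p2 - p1) + \<kappa>1 * (p2 - p4) + \<kappa>2 * (p2 - q3) + \<kappa>2 * (p2 - q2))
   + p3 * (\<kappa>1 * (p3 - p4) + \<kappa>1 * (p3 - p1) + \<kappa>2 * (p3 - q2) + \<kappa>2 * (p3 - q3))
   + p4 * (\<kappa>1 * (p4 - p3) + \<kappa>1 * (p4 - p2) + \<kappa>2 * (p4 - q4) + \<kappa>2 * (p4 - q1))
   + q1 * (\<kappa>1 * (q1 - q2) + \<kappa>1 * (q1 - q3) + \<kappa>2 * (q1 - p1) + \<kappa>2 * (q1 - p4))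
   + q2 * (\<kappa>1 * (q2 - q1) + \<kappa>1 * (q2 - q4) + \<kappa>2 * (q2 - p3) + \<kappa>2 * (q2 - p2))
   + q3 * (\<kappa>1 * (q3 - q4) + \<kappa>1 * (q3 - q1) + \<kappa>2 * (q3 - p2) + \<kappa>2 * (q3 - p3))
   + q4 * (\<kappa>1 * (q4 - q3) + \<kappa>1 * (q4 - q2) + \<kappa>2 * (q4 - p4) + \<kappa>2 * (q4 - p1))"
  (is "0 \<le> ?L")
proof -
  have "?L = \<kappa>1 * ((p1 - p2)\<^sup>2 + (p3 - p4)\<^sup>2 + (p1 - p3)\<^sup>2 + (p2 - p4)\<^sup>2
        + (q1 - q2)\<^sup>2 + (q3 - q4)\<^sup>2 + (q1 - q3)\<^sup>2 + (q2 - q4)\<^sup>2)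
      + \<kappa>2 * ((p1 - q1)\<^sup>2 + (p1 - q4)\<^sup>2 + (p2 - q3)\<^sup>2 + (p2 - q2)\<^sup>2
        + (p3 - q2)\<^sup>2 + (p3 - q3)\<^sup>2 + (p4 - q4)\<^sup>2 + (p4 - q1)\<^sup>2)"
    by (simp add: power2_eq_square algebra_simps)
  also have "\<dots> \<ge> 0" using assms by (intro add_nonneg_nonneg mult_nonneg_nonneg) auto
  finally show ?thesis .
qed

text \<open>Let \<open>V t\<close> be the sum of \<open>d\<^sup>2\<close> over the orbit of \<open>(t a, t b)\<close>. The equation expresses \<open>t V' t\<close> by the right-hand
  side, which is at most \<open>2 C t V t\<close>, minus twice a nonnegative form. So \<open>V t exp (- 2 C t)\<close> is nonincreasing on
  \<open>[0, 1]\<close>, nonnegative, and zero at \<open>0\<close>.\<close>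

lemma euler_reflection_equation_zero:
  fixes d p q :: "real \<times> real \<Rightarrow> real"
  assumes k: "\<kappa>1 \<ge> 0" "\<kappa>2 \<ge> 0"
    and D: "\<And>z. (d has_derivative (\<lambda>h. fst h * p z + snd h * q z)) (at z)"
    and eq: "\<And>a b. a * p (a, b) + b * q (a, b)
       + \<kappa>1 * (d (a, b) - d (- a, b)) + \<kappa>1 * (d (a, b) - d (a, - b))
       + \<kappa>2 * (d (a, b) - d (b, a)) + \<kappa>2 * (d (a, b) - d (- b, - a))
       = (a * y1 + b * y2) * d (a, b)"
    and d0: "d (0, 0) = 0"
  shows "d (a, b) = 0"
proof -
  define S :: "(real \<Rightarrow> real \<Rightarrow> real) \<Rightarrow> real" where
    "S F = F a b + F (- a) b + F a (- b) + F (- a) (- b) + F b a + F (- b) a + F b (- a) + F (- b) (- a)" for F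
  define A where "A = (\<lambda>u v. \<kappa>1 * (d (u, v) - d (- u, v)) + \<kappa>1 * (d (u, v) - d (u, - v))
       + \<kappa>2 * (d (u, v) - d (v, u)) + \<kappa>2 * (d (u, v) - d (- v, - u)))"
  define V where "V t = S (\<lambda>u v. (d (t * u, t * v))\<^sup>2)" for t
  define V' where "V' t = S (\<lambda>u v. 2 * d (t * u, t * v) * (u * p (t * u, t * v) + v * q (t * u, t * v)))" for t
  define C where "C = (\<bar>a\<bar> + \<bar>b\<bar>) * (\<bar>y1\<bar> + \<bar>y2\<bar>)"
  have line: "((\<lambda>t. d (t * u, t * v)) has_field_derivative u * p (t * u, t * v) + v * q (t * u, t * v)) (at t)" for u v t
  proof -
    have "((\<lambda>t. d (t * u, t * v)) has_derivative (\<lambda>h. fst (h * u, h * v) * p (t * u, t * v) + snd (h * u, h * v) * q (t * u, t * v))) (at t)"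
      by (rule has_derivative_compose[where g=d and f="\<lambda>t. (t * u, t * v)", OF _ D])
        (auto intro!: derivative_eq_intros)
    also have "(\<lambda>h. fst (h * u, h * v) * p (t * u, t * v) + snd (h * u, h * v) * q (t * u, t * v))
        = (*) (u * p (t * u, t * v) + v * q (t * u, t * v))"
      by (auto simp: fun_eq_iff algebra_simps)
    finally show ?thesis by (simp only: has_field_derivative_def)
  qed
  have V: "(V has_field_derivative V' t) (at t)" for t
    unfolding V_def S_def V'_def
    by (rule derivative_eq_intros line refl)+ (simp add: algebra_simps)
  have S_mono: "S F \<le> S G" if "\<And>u v. \<bar>u\<bar> \<le> \<bar>a\<bar> + \<bar>b\<bar> \<Longrightarrow> \<bar>v\<bar> \<le> \<bar>a\<bar> + \<bar>b\<bar> \<Longrightarrow> F u v \<le> G u v" for F G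
    unfolding S_def by (intro add_mono that) auto
  have tV: "t * V' t \<le> t * (2 * C * V t)" if t: "t \<ge> 0" for t
  proof -
    \<comment> \<open>positivity of the reflection part\<close>
    have AS: "0 \<le> S (\<lambda>u v. d (t * u, t * v) * A (t * u) (t * v))"
      unfolding S_def A_def mult_minus_right minus_minus
      by (rule reflection_form_nonneg[OF k])
    have "t * V' t = S (\<lambda>u v. 2 * d (t * u, t * v) * ((t * u) * p (t * u, t * v) + (t * v) * q (t * u, t * v)))"
      unfolding V'_def S_def by (simp add: algebra_simps)
    also have "\<dots> = S (\<lambda>u v. 2 * t * (u * y1 + v * y2) * (d (t * u, t * v))\<^sup>2 - 2 * (d (t * u, t * v) * A (t * u) (t * v)))"
    proof -
      have e: "(t * u) * p (t * u, t * v) + (t * v) * q (t * u, t * v)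
         = t * (u * y1 + v * y2) * d (t * u, t * v) - A (t * u) (t * v)" for u v
        using eq[of "t * u" "t * v"] by (simp add: A_def algebra_simps)
      show ?thesis unfolding e by (simp add: power2_eq_square algebra_simps)
    qed
    also have "\<dots> = S (\<lambda>u v. 2 * t * (u * y1 + v * y2) * (d (t * u, t * v))\<^sup>2)
        - 2 * S (\<lambda>u v. d (t * u, t * v) * A (t * u) (t * v))"
      unfolding S_def by (simp add: algebra_simps)
    also have "\<dots> \<le> S (\<lambda>u v. 2 * t * (u * y1 + v * y2) * (d (t * u, t * v))\<^sup>2)"
      using AS by simp
    also have "\<dots> \<le> S (\<lambda>u v. 2 * t * C * (d (t * u, t * v))\<^sup>2)"
    proof (rule S_mono)
      fix u v assume uv: "\<bar>u\<bar> \<le> \<bar>a\<bar> + \<bar>b\<bar>" "\<bar>v\<bar> \<le> \<bar>a\<bar> + \<bar>b\<bar>"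
      have "u * y1 + v * y2 \<le> \<bar>u\<bar> * \<bar>y1\<bar> + \<bar>v\<bar> * \<bar>y2\<bar>"
        by (metis abs_mult abs_ge_self add_mono)
      also have "\<dots> \<le> C"
        unfolding C_def distrib_left by (intro add_mono mult_right_mono uv) auto
      finally have "2 * t * (u * y1 + v * y2) \<le> 2 * t * C"
        using t by (intro mult_left_mono) auto
      then show "2 * t * (u * y1 + v * y2) * (d (t * u, t * v))\<^sup>2 \<le> 2 * t * C * (d (t * u, t * v))\<^sup>2"
        by (intro mult_right_mono) auto
    qed
    also have "\<dots> = t * (2 * C * V t)"
      unfolding V_def S_def by (simp add: algebra_simps)
    finally show ?thesis .
  qed
  have V0: "V 0 = 0" "V' 0 = 0" by (simp_all add: V_def V'_def S_def d0)
  have "V 1 * exp (- 2 * C * 1) \<le> V 0 * exp (- 2 * C * 0)"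
  proof (rule DERIV_nonpos_imp_nonincreasing[where f="\<lambda>t. V t * exp (- 2 * C * t)"])
    fix t :: real assume t: "0 \<le> t" "t \<le> 1"
    have "((\<lambda>t. V t * exp (- 2 * C * t)) has_field_derivative (V' t - 2 * C * V t) * exp (- 2 * C * t)) (at t)"
      by (auto intro!: derivative_eq_intros V simp: algebra_simps)
    moreover have "V' t - 2 * C * V t \<le> 0"
    proof (cases "t = 0")
      case False
      with t tV[of t] show ?thesis by simp
    qed (simp add: V0)
    ultimately show "\<exists>y. ((\<lambda>t. V t * exp (- 2 * C * t)) has_real_derivative y) (at t) \<and> y \<le> 0"
      by (intro exI conjI) (auto intro: mult_nonpos_nonneg)
  qed simp
  then have "V 1 \<le> 0" by (simp add: V0 mult_le_0_iff)
  moreover have "(d (a, b))\<^sup>2 \<le> V 1" unfolding V_def S_def by simp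
  ultimately have "(d (a, b))\<^sup>2 \<le> 0" by linarith
  then show ?thesis by simp
qed

lemma is_dunkl_kernel_unique:
  assumes k: "\<kappa>1 \<ge> 0" "\<kappa>2 \<ge> 0" and f: "is_dunkl_kernel \<kappa>1 \<kappa>2 y f" and g: "is_dunkl_kernel \<kappa>1 \<kappa>2 y g"
  shows "f = g"
proof
  fix x :: "real \<times> real"
  have ker: "real_analytic2 f" "real_analytic2 g" "f (0, 0) = 1" "g (0, 0) = 1"
    using f g by (auto simp: is_dunkl_kernel_def)
  have "(\<lambda>x. f x - g x) (fst x, snd x) = 0"
  proof (rule euler_reflection_equation_zero[OF k, where
        p="\<lambda>x. deriv (\<lambda>t. f (t, snd x)) (fst x) - deriv (\<lambda>t. g (t, snd x)) (fst x)" and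
        q="\<lambda>x. deriv (\<lambda>t. f (fst x, t)) (snd x) - deriv (\<lambda>t. g (fst x, t)) (snd x)" and
        ?y1.0="fst y" and ?y2.0="snd y"])
    fix z
    show "((\<lambda>x. f x - g x) has_derivative (\<lambda>h. fst h * (deriv (\<lambda>t. f (t, snd z)) (fst z) - deriv (\<lambda>t. g (t, snd z)) (fst z))
        + snd h * (deriv (\<lambda>t. f (fst z, t)) (snd z) - deriv (\<lambda>t. g (fst z, t)) (snd z)))) (at z)"
      by (rule has_derivative_eq_rhs[OF has_derivative_diff[OF real_analytic2_has_derivative[OF ker(1)]
            real_analytic2_has_derivative[OF ker(2)]]]) (simp add: fun_eq_iff algebra_simps)
  next
    fix a b
    have "a * dunkl_T1 \<kappa>1 \<kappa>2 h (a, b) + b * dunkl_T2 \<kappa>1 \<kappa>2 h (a, b) = (a * fst y + b * snd y) * h (a, b)"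
      if "is_dunkl_kernel \<kappa>1 \<kappa>2 y h" for h
      using that by (simp add: is_dunkl_kernel_def algebra_simps)
    from this[OF f] this[OF g]
    show "a * (deriv (\<lambda>t. f (t, snd (a, b))) (fst (a, b)) - deriv (\<lambda>t. g (t, snd (a, b))) (fst (a, b)))
       + b * (deriv (\<lambda>t. f (fst (a, b), t)) (snd (a, b)) - deriv (\<lambda>t. g (fst (a, b), t)) (snd (a, b)))
       + \<kappa>1 * (f (a, b) - g (a, b) - (f (- a, b) - g (- a, b))) + \<kappa>1 * (f (a, b) - g (a, b) - (f (a, - b) - g (a, - b)))
       + \<kappa>2 * (f (a, b) - g (a, b) - (f (b, a) - g (b, a))) + \<kappa>2 * (f (a, b) - g (a, b) - (f (- b, - a) - g (- b, - a)))
       = (a * fst y + b * snd y) * (f (a, b) - g (a, b))"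
      unfolding dunkl_euler_identity by (simp add: algebra_simps)
  qed (simp add: ker)
  then show "f x = g x" by simp
qed

section \<open>Gegenbauer weights\<close>

definition gegenbauer :: "real \<Rightarrow> real measure" where
  "gegenbauer \<kappa> = density lborel (\<lambda>u. indicator {-1..1} u * (1 - u\<^sup>2) powr (\<kappa> - 1))"

text \<open>The first variable \<open>u\<close> belongs to the exchange of coordinates (multiplicity \<open>\<kappa>2\<close>), the second variable \<open>v\<close>
  to the sign changes (multiplicity \<open>\<kappa>1\<close>).\<close>

definition gegenbauer2 :: "real \<Rightarrow> real \<Rightarrow> (real \<times> real) measure" where
  "gegenbauer2 \<kappa>1 \<kappa>2 = gegenbauer \<kappa>2 \<Otimes>\<^sub>M gegenbauer \<kappa>1"

text \<open>The real case follows from the complex one because \<open>Gamma\<close> commutes with the embedding of the reals.\<close>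

lemma Gamma_duplication_real:
  fixes z :: real
  assumes "z > 0"
  shows "Gamma z * Gamma (z + 1/2) = 2 powr (1 - 2*z) * sqrt pi * Gamma (2*z)"
proof -
  have nn: "complex_of_real w \<notin> \<int>\<^sub>\<le>\<^sub>0" if "w > 0" for w
    using that by (auto elim!: nonpos_Ints_cases simp: complex_eq_iff)
  have "Gamma (complex_of_real z) * Gamma (complex_of_real z + 1/2) =
     exp ((1 - 2 * complex_of_real z) * of_real (ln 2)) * of_real (sqrt pi) * Gamma (2 * complex_of_real z)"
    using nn[of z] nn[of "z + 1/2"] assms by (intro Gamma_legendre_duplication) auto
  also have "complex_of_real z + 1/2 = of_real (z + 1/2)" by simp
  also have "2 * complex_of_real z = of_real (2 * z)" by simp
  also have "exp ((1 - of_real (2*z)) * complex_of_real (ln 2)) = of_real (2 powr (1 - 2*z))"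
    by (simp add: powr_def exp_of_real [symmetric])
  finally have "complex_of_real (Gamma z * Gamma (z + 1/2)) = of_real (2 powr (1 - 2*z) * sqrt pi * Gamma (2*z))"
    unfolding Gamma_complex_of_real by simp
  then show ?thesis unfolding of_real_eq_iff .
qed

text \<open>The substitution \<open>t = (1 + u) / 2\<close> turns \<open>1 - u\<^sup>2\<close> into \<open>4 t (1 - t)\<close>, so the mass is a Beta integral with equal
  arguments, which the duplication formula brings to the normalisation used in \<open>c_B2\<close>.\<close>

lemma has_integral_gegenbauer_weight:
  assumes "\<kappa> > 0"
  shows "((\<lambda>u. (1 - u\<^sup>2) powr (\<kappa> - 1)) has_integral
           sqrt pi * Gamma \<kappa> / Gamma (\<kappa> + 1/2)) {-1..1}"
proof -
  have "((\<lambda>u::real. ((1/2) *\<^sub>R u + 1/2) powr (\<kappa>-1) * (1 - ((1/2) *\<^sub>R u + 1/2)) powr (\<kappa>-1))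
      has_integral (Beta \<kappa> \<kappa> /\<^sub>R (1/2) ^ DIM(real))) (cbox ((0 - 1/2) /\<^sub>R (1/2)) ((1 - 1/2) /\<^sub>R (1/2)))"
    by (rule has_integral_affinity') (use has_integral_Beta_real[OF assms assms] in auto)
  then have "((\<lambda>u::real. 4 powr (\<kappa> - 1) * (((1/2) *\<^sub>R u + 1/2) powr (\<kappa>-1) * (1 - ((1/2) *\<^sub>R u + 1/2)) powr (\<kappa>-1)))
      has_integral (4 powr (\<kappa> - 1) * (2 * Beta \<kappa> \<kappa>))) {-1..1}"
    by (intro has_integral_mult_right) simp
  moreover have "4 powr (\<kappa> - 1) * (((1/2) *\<^sub>R u + 1/2) powr (\<kappa>-1) * (1 - ((1/2) *\<^sub>R u + 1/2)) powr (\<kappa>-1))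
      = (1 - u\<^sup>2) powr (\<kappa> - 1)" if "u \<in> {-1..1}" for u :: real
  proof -
    have e: "1 - u\<^sup>2 = 4 * (((1/2) *\<^sub>R u + 1/2) * (1 - ((1/2) *\<^sub>R u + 1/2)))"
      by (simp add: power2_eq_square field_simps)
    show ?thesis unfolding e using that by (simp add: powr_mult)
  qed
  ultimately have *: "((\<lambda>u. (1 - u\<^sup>2) powr (\<kappa> - 1)) has_integral (4 powr (\<kappa> - 1) * (2 * Beta \<kappa> \<kappa>))) {-1..1}"
    by (rule has_integral_eq[rotated]) auto
  have g: "Gamma \<kappa> > 0" "Gamma (\<kappa> + 1/2) > 0" "Gamma (2*\<kappa>) > 0"
    using assms by (auto intro: Gamma_real_pos)
  have "2 powr (1 - 2*\<kappa>) * (4 powr (\<kappa> - 1) * 2) = 2 powr (1 - 2*\<kappa>) * (2 powr (2 * (\<kappa> - 1)) * 2 powr 1)"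
    using powr_powr[of "2::real" 2 "\<kappa> - 1"] by simp
  also have "\<dots> = 1" unfolding powr_add [symmetric] by simp
  finally have p: "2 powr (1 - 2*\<kappa>) * (4 powr (\<kappa> - 1) * 2) = 1" .
  have "4 powr (\<kappa> - 1) * (2 * Beta \<kappa> \<kappa>) * Gamma (\<kappa> + 1/2) * Gamma (2*\<kappa>)
      = 4 powr (\<kappa> - 1) * 2 * Gamma \<kappa> * (Gamma \<kappa> * Gamma (\<kappa> + 1/2))"
    using g by (simp add: Beta_def field_simps)
  also have "\<dots> = (2 powr (1 - 2*\<kappa>) * (4 powr (\<kappa> - 1) * 2)) * sqrt pi * Gamma \<kappa> * Gamma (2*\<kappa>)"
    unfolding Gamma_duplication_real[OF assms] by (simp only: ac_simps)
  finally have "4 powr (\<kappa> - 1) * (2 * Beta \<kappa> \<kappa>) = sqrt pi * Gamma \<kappa> / Gamma (\<kappa> + 1/2)"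
    unfolding p using g by (simp add: field_simps)
  with * show ?thesis by simp
qed

lemma sets_gegenbauer [measurable_cong, simp]: "sets (gegenbauer \<kappa>) = sets borel"
  and space_gegenbauer [simp]: "space (gegenbauer \<kappa>) = UNIV"
  by (simp_all add: gegenbauer_def)

lemma measurable_gegenbauer_weight [measurable]:
  "(\<lambda>u::real. indicator {-1..1} u * (1 - u\<^sup>2) powr (\<kappa> - 1) :: real) \<in> borel_measurable borel"
  by measurable

lemma emeasure_gegenbauer_UNIV:
  assumes "\<kappa> > 0"
  shows "emeasure (gegenbauer \<kappa>) UNIV = ennreal (sqrt pi * Gamma \<kappa> / Gamma (\<kappa> + 1/2))"
proof -
  have "emeasure (gegenbauer \<kappa>) UNIV
      = (\<integral>\<^sup>+u. ennreal (indicator {-1..1} u * (1 - u\<^sup>2) powr (\<kappa> - 1)) \<partial>lborel)"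
    unfolding gegenbauer_def by (subst emeasure_density) auto
  also have "\<dots> = ennreal (sqrt pi * Gamma \<kappa> / Gamma (\<kappa> + 1/2))"
    by (rule nn_integral_has_integral_lebesgue[OF _ has_integral_gegenbauer_weight[OF assms]]) simp
  finally show ?thesis .
qed

lemma finite_measure_gegenbauer: "\<kappa> > 0 \<Longrightarrow> finite_measure (gegenbauer \<kappa>)"
  by (rule finite_measureI) (simp add: emeasure_gegenbauer_UNIV)

lemma measure_gegenbauer_UNIV:
  assumes "\<kappa> > 0"
  shows "measure (gegenbauer \<kappa>) UNIV = sqrt pi * Gamma \<kappa> / Gamma (\<kappa> + 1/2)"
  using emeasure_gegenbauer_UNIV[OF assms] assms
  by (simp add: measure_def Gamma_real_nonneg)

lemma AE_gegenbauer: "AE u in gegenbauer \<kappa>. u \<in> {-1..1}"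
  unfolding gegenbauer_def by (subst AE_density) (auto simp: indicator_def)

lemma integral_gegenbauer:
  fixes h :: "real \<Rightarrow> real"
  assumes [measurable]: "h \<in> borel_measurable borel"
  shows "(\<integral>u. h u \<partial>gegenbauer \<kappa>) = (LBINT u:{-1..1}. h u * (1 - u\<^sup>2) powr (\<kappa> - 1))"
  unfolding gegenbauer_def set_lebesgue_integral_def
  by (subst integral_real_density) (auto intro!: Bochner_Integration.integral_cong)

lemma integrable_gegenbauer:
  fixes h :: "real \<Rightarrow> real"
  assumes "\<kappa> > 0" and h: "continuous_on UNIV h"
  shows "integrable (gegenbauer \<kappa>) h"
proof -
  interpret finite_measure "gegenbauer \<kappa>" by (rule finite_measure_gegenbauer) fact
  have "compact (h ` {-1..1})"
    by (rule compact_continuous_image) (auto intro: continuous_on_subset[OF h])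
  then obtain B where "\<forall>u\<in>{-1..1}. norm (h u) \<le> B"
    by (auto dest!: compact_imp_bounded simp: bounded_iff)
  then show ?thesis using AE_gegenbauer[of \<kappa>]
    by (intro integrable_const_bound[where B=B])
      (auto simp: measurable_cong_sets[OF sets_gegenbauer refl] intro: borel_measurable_continuous_onI h)
qed

lemma integral_gegenbauer_reflect:
  fixes h :: "real \<Rightarrow> real"
  assumes [measurable]: "h \<in> borel_measurable borel"
  shows "(\<integral>u. h (-u) \<partial>gegenbauer \<kappa>) = (\<integral>u. h u \<partial>gegenbauer \<kappa>)"
  unfolding integral_gegenbauer[OF assms] set_lebesgue_integral_def
  by (subst integral_gegenbauer, simp, unfold set_lebesgue_integral_def,
      subst (2) lborel_integral_real_affine[where c="-1" and t=0])
    (auto intro!: Bochner_Integration.integral_cong split: split_indicator)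

text \<open>The primitive \<open>- (1 - u\<^sup>2) powr \<kappa> * h u\<close> vanishes at both endpoints, since \<open>\<kappa> > 0\<close>, although the weight
  is unbounded there for \<open>\<kappa> < 1\<close>; so the fundamental theorem is applied with continuity on the closed interval and
  derivatives in the open one.\<close>

lemma integral_gegenbauer_by_parts:
  assumes "\<kappa> > 0"
    and d: "\<And>u. (h has_field_derivative h' u) (at u)" and h': "continuous_on UNIV h'"
  shows "(\<integral>u. 2 * \<kappa> * u * h u \<partial>gegenbauer \<kappa>) = (\<integral>u. (1 - u\<^sup>2) * h' u \<partial>gegenbauer \<kappa>)"
proof -
  have h: "continuous_on UNIV h"
    using d by (meson DERIV_isCont continuous_at_imp_continuous_on)
  let ?w = "\<lambda>u::real. (1 - u\<^sup>2) powr (\<kappa> - 1)"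
  let ?g = "\<lambda>u. (2 * \<kappa> * u * h u - (1 - u\<^sup>2) * h' u)"
  have cg: "continuous_on UNIV ?g"
    by (intro continuous_intros h h')
  have "((\<lambda>u. ?g u * ?w u) has_integral (- ((1 - 1\<^sup>2) powr \<kappa> * h 1) - - ((1 - (-1)\<^sup>2) powr \<kappa> * h (-1)))) {-1..1}"
  proof (rule fundamental_theorem_of_calculus_interior)
    show "continuous_on {-1..1} (\<lambda>u. - ((1 - u\<^sup>2) powr \<kappa> * h u))"
      using assms(1) by (intro continuous_intros continuous_on_subset[OF h] continuous_on_powr')
        (auto simp: abs_square_le_1 abs_le_iff)
    fix u :: real assume u: "u \<in> {-1<..<1}"
    then have u2: "1 - u\<^sup>2 > 0" by (simp add: abs_square_less_1 abs_less_iff)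
    have "((\<lambda>u. - ((1 - u\<^sup>2) powr \<kappa> * h u)) has_field_derivative
        - (\<kappa> * (1 - u\<^sup>2) powr (\<kappa> - 1) * (- 2 * u) * h u + h' u * (1 - u\<^sup>2) powr \<kappa>)) (at u)"
      using u2 by (auto intro!: derivative_eq_intros d)
    also have "(1 - u\<^sup>2) powr \<kappa> = (1 - u\<^sup>2) * ?w u"
      using u2 by (simp add: powr_diff)
    finally show "((\<lambda>u. - ((1 - u\<^sup>2) powr \<kappa> * h u)) has_vector_derivative ?g u * ?w u) (at u)"
      by (simp add: has_real_derivative_iff_has_vector_derivative [symmetric] algebra_simps)
  qed simp
  then have 1: "((\<lambda>u. ?g u * ?w u) has_integral 0) {-1..1}" using assms(1) by simp
  have [measurable]: "?g \<in> borel_measurable borel"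
    by (rule borel_measurable_continuous_onI) fact
  have "integrable (gegenbauer \<kappa>) ?g" by (rule integrable_gegenbauer) fact+
  then have "integrable lborel (\<lambda>u. indicator {-1..1} u * ?w u * ?g u)"
    unfolding gegenbauer_def by (subst (asm) integrable_real_density) auto
  then have "set_integrable lborel {-1..1} (\<lambda>u. ?g u * ?w u)"
    unfolding set_integrable_def by (simp add: mult_ac)
  then have "(LBINT u:{-1..1}. ?g u * ?w u) = integral {-1..1} (\<lambda>u. ?g u * ?w u)"
    by (rule set_borel_integral_eq_integral)
  also have "\<dots> = 0" using 1 by (rule integral_unique)
  finally have "(\<integral>u. ?g u \<partial>gegenbauer \<kappa>) = 0"
    by (subst integral_gegenbauer) auto
  moreover have "(\<integral>u. ?g u \<partial>gegenbauer \<kappa>) =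
     (\<integral>u. 2 * \<kappa> * u * h u \<partial>gegenbauer \<kappa>) - (\<integral>u. (1 - u\<^sup>2) * h' u \<partial>gegenbauer \<kappa>)"
    using assms(1) by (intro Bochner_Integration.integral_diff integrable_gegenbauer continuous_intros h h')
  ultimately show ?thesis by simp
qed

text \<open>This is the mechanism behind the Dunkl equations: a reflection difference, weighted by \<open>1 + u\<close>, becomes an
  integral of the derivative. By the symmetry of the measure the left-hand side is the integral of
  \<open>2 \<kappa> u h u\<close>.\<close>

lemma integral_gegenbauer_reflection_difference:
  assumes "\<kappa> > 0"
    and d: "\<And>u. (h has_field_derivative h' u) (at u)" and h': "continuous_on UNIV h'"
  shows "\<kappa> * (\<integral>u. (h u - h (- u)) * (1 + u) \<partial>gegenbauer \<kappa>) = (\<integral>u. (1 - u\<^sup>2) * h' u \<partial>gegenbauer \<kappa>)"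
proof -
  have h: "continuous_on UNIV h"
    using d by (meson DERIV_isCont continuous_at_imp_continuous_on)
  have hm: "continuous_on UNIV (\<lambda>u. h (- u))"
    by (rule continuous_on_compose2[OF h]) (auto intro: continuous_intros)
  note i = integrable_gegenbauer[OF assms(1)]
  have "(\<integral>u. h (- u) * (1 + u) \<partial>gegenbauer \<kappa>) = (\<integral>u. h u * (1 - u) \<partial>gegenbauer \<kappa>)"
    using integral_gegenbauer_reflect[of "\<lambda>u. h u * (1 - u)" \<kappa>]
    by (simp add: borel_measurable_continuous_onI continuous_intros h)
  then have "(\<integral>u. (h u - h (- u)) * (1 + u) \<partial>gegenbauer \<kappa>)
      = (\<integral>u. h u * (1 + u) \<partial>gegenbauer \<kappa>) - (\<integral>u. h u * (1 - u) \<partial>gegenbauer \<kappa>)"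
    by (simp add: left_diff_distrib Bochner_Integration.integral_diff i continuous_intros h hm)
  also have "\<dots> = (\<integral>u. h u * (1 + u) - h u * (1 - u) \<partial>gegenbauer \<kappa>)"
    by (intro Bochner_Integration.integral_diff [symmetric] i continuous_intros h)
  also have "\<kappa> * \<dots> = (\<integral>u. 2 * \<kappa> * u * h u \<partial>gegenbauer \<kappa>)"
    by (subst integral_mult_right_zero [symmetric]) (simp add: algebra_simps)
  also have "\<dots> = (\<integral>u. (1 - u\<^sup>2) * h' u \<partial>gegenbauer \<kappa>)"
    by (rule integral_gegenbauer_by_parts) fact+
  finally show ?thesis .
qed

lemma integral_const_gegenbauer:
  "\<kappa> > 0 \<Longrightarrow> (\<integral>u. c \<partial>gegenbauer \<kappa>) = c * (sqrt pi * Gamma \<kappa> / Gamma (\<kappa> + 1/2))"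
  by (simp add: measure_gegenbauer_UNIV)

lemma pair_sigma_finite_gegenbauer:
  assumes "\<kappa>1 > 0" "\<kappa>2 > 0"
  shows "pair_sigma_finite (gegenbauer \<kappa>2) (gegenbauer \<kappa>1)"
proof -
  interpret A: finite_measure "gegenbauer \<kappa>1" by (rule finite_measure_gegenbauer) fact
  interpret B: finite_measure "gegenbauer \<kappa>2" by (rule finite_measure_gegenbauer) fact
  show ?thesis ..
qed

lemma finite_measure_gegenbauer2:
  "\<kappa>1 > 0 \<Longrightarrow> \<kappa>2 > 0 \<Longrightarrow> finite_measure (gegenbauer2 \<kappa>1 \<kappa>2)"
  unfolding gegenbauer2_def by (intro finite_measure_pair_measure finite_measure_gegenbauer)

lemma sets_gegenbauer2 [measurable_cong, simp]: "sets (gegenbauer2 \<kappa>1 \<kappa>2) = sets borel"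
proof -
  have "sets (gegenbauer2 \<kappa>1 \<kappa>2) = sets (borel \<Otimes>\<^sub>M (borel :: real measure) :: (real \<times> real) measure)"
    unfolding gegenbauer2_def by (rule sets_pair_measure_cong) simp_all
  then show ?thesis unfolding borel_prod .
qed

lemma continuous_imp_measurable_gegenbauer2:
  fixes h :: "real \<times> real \<Rightarrow> real"
  shows "continuous_on UNIV h \<Longrightarrow> h \<in> borel_measurable (gegenbauer2 \<kappa>1 \<kappa>2)"
  by (simp add: measurable_cong_sets[OF sets_gegenbauer2 refl] borel_measurable_continuous_onI)

lemma AE_gegenbauer2:
  assumes "\<kappa>1 > 0" "\<kappa>2 > 0"
  shows "AE q in gegenbauer2 \<kappa>1 \<kappa>2. q \<in> {-1..1} \<times> {-1..1}"
proof -
  interpret pair_sigma_finite "gegenbauer \<kappa>2" "gegenbauer \<kappa>1"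
    using assms by (rule pair_sigma_finite_gegenbauer)
  have m: "{-1..1} \<times> {-1..1::real} \<in> sets (gegenbauer \<kappa>2 \<Otimes>\<^sub>M gegenbauer \<kappa>1)" by simp
  show ?thesis unfolding gegenbauer2_def
  proof (rule AE_pair_measure)
    show "{x \<in> space (gegenbauer \<kappa>2 \<Otimes>\<^sub>M gegenbauer \<kappa>1). x \<in> {-1..1} \<times> {-1..1}}
       \<in> sets (gegenbauer \<kappa>2 \<Otimes>\<^sub>M gegenbauer \<kappa>1)"
      using m by (simp add: space_pair_measure)
    have "AE u in gegenbauer \<kappa>2. u \<in> {-1..1}" by (rule AE_gegenbauer)
    then show "AE u in gegenbauer \<kappa>2. AE v in gegenbauer \<kappa>1. (u, v) \<in> {-1..1} \<times> {-1..1}"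
    proof eventually_elim
      case (elim u)
      show ?case using AE_gegenbauer[of \<kappa>1] by eventually_elim (use elim in auto)
    qed
  qed
qed

lemma compact_square: "compact ({-1..1::real} \<times> {-1..1::real})"
  by (intro compact_Times) auto

lemma continuous_bounded_on_square:
  fixes h :: "real \<times> real \<Rightarrow> real"
  assumes "continuous_on UNIV h"
  obtains B where "B \<ge> 0" "\<And>q. q \<in> {-1..1} \<times> {-1..1} \<Longrightarrow> \<bar>h q\<bar> \<le> B"
proof -
  have "compact (h ` ({-1..1} \<times> {-1..1}))"
    by (intro compact_continuous_image continuous_on_subset[OF assms] compact_square) auto
  then obtain B where "\<forall>q\<in>{-1..1} \<times> {-1..1}. norm (h q) \<le> B"
    by (auto dest!: compact_imp_bounded simp: bounded_iff)
  then show ?thesis by (intro that[of "max B 0"]) (force simp: le_max_iff_disj)+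
qed

lemma integrable_gegenbauer2:
  fixes h :: "real \<times> real \<Rightarrow> real"
  assumes "\<kappa>1 > 0" "\<kappa>2 > 0" and h: "continuous_on UNIV h"
  shows "integrable (gegenbauer2 \<kappa>1 \<kappa>2) h"
proof -
  interpret finite_measure "gegenbauer2 \<kappa>1 \<kappa>2" by (rule finite_measure_gegenbauer2) fact+
  obtain B where "\<And>q. q \<in> {-1..1} \<times> {-1..1} \<Longrightarrow> \<bar>h q\<bar> \<le> B"
    using continuous_bounded_on_square[OF h] by blast
  then show ?thesis using AE_gegenbauer2[OF assms(1,2)]
    by (intro integrable_const_bound[where B=B] continuous_imp_measurable_gegenbauer2 h) auto
qed

lemma integral_gegenbauer2_iterated:
  fixes h :: "real \<times> real \<Rightarrow> real"
  assumes "\<kappa>1 > 0" "\<kappa>2 > 0" and h: "continuous_on UNIV h"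
  shows "(\<integral>q. h q \<partial>gegenbauer2 \<kappa>1 \<kappa>2) = (\<integral>v. (\<integral>u. h (u, v) \<partial>gegenbauer \<kappa>2) \<partial>gegenbauer \<kappa>1)"
    and "(\<integral>q. h q \<partial>gegenbauer2 \<kappa>1 \<kappa>2) = (\<integral>u. (\<integral>v. h (u, v) \<partial>gegenbauer \<kappa>1) \<partial>gegenbauer \<kappa>2)"
proof -
  interpret pair_sigma_finite "gegenbauer \<kappa>2" "gegenbauer \<kappa>1"
    using assms(1,2) by (rule pair_sigma_finite_gegenbauer)
  have i: "integrable (gegenbauer \<kappa>2 \<Otimes>\<^sub>M gegenbauer \<kappa>1) (case_prod (\<lambda>u v. h (u, v)))"
    using integrable_gegenbauer2[OF assms] by (simp add: gegenbauer2_def)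
  show "(\<integral>q. h q \<partial>gegenbauer2 \<kappa>1 \<kappa>2) = (\<integral>v. (\<integral>u. h (u, v) \<partial>gegenbauer \<kappa>2) \<partial>gegenbauer \<kappa>1)"
    using integral_snd[OF i] by (simp add: gegenbauer2_def)
  show "(\<integral>q. h q \<partial>gegenbauer2 \<kappa>1 \<kappa>2) = (\<integral>u. (\<integral>v. h (u, v) \<partial>gegenbauer \<kappa>1) \<partial>gegenbauer \<kappa>2)"
    using integral_fst[OF i] by (simp add: gegenbauer2_def)
qed

text \<open>The constant \<open>c_B2\<close> is the reciprocal of the total mass.\<close>

lemma integral_const_gegenbauer2:
  assumes "\<kappa>1 > 0" "\<kappa>2 > 0"
  shows "c_B2 \<kappa>1 \<kappa>2 * (\<integral>q. 1 \<partial>gegenbauer2 \<kappa>1 \<kappa>2) = 1"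
proof -
  have g: "Gamma \<kappa>1 > 0" "Gamma (\<kappa>1 + 1/2) > 0" "Gamma \<kappa>2 > 0" "Gamma (\<kappa>2 + 1/2) > 0"
    using assms by (auto intro: Gamma_real_pos)
  show ?thesis
    unfolding integral_gegenbauer2_iterated(1)[OF assms continuous_on_const]
      integral_const_gegenbauer[OF assms(1)] integral_const_gegenbauer[OF assms(2)] c_B2_def
    using g by (simp add: field_simps)
qed

lemma continuous_on_section:
  fixes h :: "real \<times> real \<Rightarrow> real"
  assumes h: "continuous_on UNIV h"
  shows "continuous_on UNIV (\<lambda>u. h (u, v))" "continuous_on UNIV (\<lambda>v. h (u, v))"
  by (auto intro!: continuous_on_compose2[OF h] continuous_intros)

lemma continuous_on_reflect:
  fixes h :: "real \<times> real \<Rightarrow> real"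
  assumes h: "continuous_on UNIV h"
  shows "continuous_on UNIV (\<lambda>q. h (- fst q, snd q))" "continuous_on UNIV (\<lambda>q. h (fst q, - snd q))"
  by (auto intro!: continuous_on_compose2[OF h] continuous_intros)

lemma integral_gegenbauer2_reflect:
  fixes h :: "real \<times> real \<Rightarrow> real"
  assumes "\<kappa>1 > 0" "\<kappa>2 > 0" and h: "continuous_on UNIV h"
  shows "(\<integral>q. h (- fst q, snd q) \<partial>gegenbauer2 \<kappa>1 \<kappa>2) = (\<integral>q. h q \<partial>gegenbauer2 \<kappa>1 \<kappa>2)"
    and "(\<integral>q. h (fst q, - snd q) \<partial>gegenbauer2 \<kappa>1 \<kappa>2) = (\<integral>q. h q \<partial>gegenbauer2 \<kappa>1 \<kappa>2)"
proof -
  note [simp] = borel_measurable_continuous_onI[OF continuous_on_section(1)[OF h]]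
    borel_measurable_continuous_onI[OF continuous_on_section(2)[OF h]]
  show "(\<integral>q. h (- fst q, snd q) \<partial>gegenbauer2 \<kappa>1 \<kappa>2) = (\<integral>q. h q \<partial>gegenbauer2 \<kappa>1 \<kappa>2)"
    using integral_gegenbauer_reflect[of "\<lambda>u. h (u, _)"]
    by (simp add: integral_gegenbauer2_iterated(1)[OF assms(1,2)] continuous_on_reflect h)
  show "(\<integral>q. h (fst q, - snd q) \<partial>gegenbauer2 \<kappa>1 \<kappa>2) = (\<integral>q. h q \<partial>gegenbauer2 \<kappa>1 \<kappa>2)"
    using integral_gegenbauer_reflect[of "\<lambda>v. h (_, v)"]
    by (simp add: integral_gegenbauer2_iterated(2)[OF assms(1,2)] continuous_on_reflect h)
qed

lemma integral_gegenbauer2_reflection_difference: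
  fixes h :: "real \<times> real \<Rightarrow> real"
  assumes k: "\<kappa>1 > 0" "\<kappa>2 > 0" and h: "continuous_on UNIV h"
  shows "(\<And>u v. ((\<lambda>u. h (u, v)) has_field_derivative h' (u, v)) (at u)) \<Longrightarrow> continuous_on UNIV h' \<Longrightarrow>
      \<kappa>2 * (\<integral>q. (h q - h (- fst q, snd q)) * (1 + fst q) \<partial>gegenbauer2 \<kappa>1 \<kappa>2)
       = (\<integral>q. (1 - (fst q)\<^sup>2) * h' q \<partial>gegenbauer2 \<kappa>1 \<kappa>2)"
    and "(\<And>u v. ((\<lambda>v. h (u, v)) has_field_derivative h' (u, v)) (at v)) \<Longrightarrow> continuous_on UNIV h' \<Longrightarrow>
      \<kappa>1 * (\<integral>q. (h q - h (fst q, - snd q)) * (1 + snd q) \<partial>gegenbauer2 \<kappa>1 \<kappa>2)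
       = (\<integral>q. (1 - (snd q)\<^sup>2) * h' q \<partial>gegenbauer2 \<kappa>1 \<kappa>2)"
proof -
  assume d: "\<And>u v. ((\<lambda>u. h (u, v)) has_field_derivative h' (u, v)) (at u)" and h': "continuous_on UNIV h'"
  show "\<kappa>2 * (\<integral>q. (h q - h (- fst q, snd q)) * (1 + fst q) \<partial>gegenbauer2 \<kappa>1 \<kappa>2)
       = (\<integral>q. (1 - (fst q)\<^sup>2) * h' q \<partial>gegenbauer2 \<kappa>1 \<kappa>2)"
    by (simp add: integral_gegenbauer2_iterated(1)[OF k] continuous_on_reflect h h' continuous_intros
      integral_gegenbauer_reflection_difference[OF k(2) d continuous_on_section(1)[OF h'], symmetric])
next
  assume d: "\<And>u v. ((\<lambda>v. h (u, v)) has_field_derivative h' (u, v)) (at v)" and h': "continuous_on UNIV h'"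
  show "\<kappa>1 * (\<integral>q. (h q - h (fst q, - snd q)) * (1 + snd q) \<partial>gegenbauer2 \<kappa>1 \<kappa>2)
       = (\<integral>q. (1 - (snd q)\<^sup>2) * h' q \<partial>gegenbauer2 \<kappa>1 \<kappa>2)"
    by (simp add: integral_gegenbauer2_iterated(2)[OF k] continuous_on_reflect h h' continuous_intros
      integral_gegenbauer_reflection_difference[OF k(1) d continuous_on_section(2)[OF h'], symmetric])
qed

text \<open>Dominated convergence: by the mean value theorem the difference quotients are bounded by the maximum of the
  derivative over a compact set.\<close>

lemma has_field_derivative_integral_gegenbauer2:
  fixes F F' :: "real \<Rightarrow> real \<times> real \<Rightarrow> real"
  assumes k: "\<kappa>1 > 0" "\<kappa>2 > 0"
    and F: "\<And>t. continuous_on UNIV (F t)"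
    and d: "\<And>t q. ((\<lambda>t. F t q) has_field_derivative F' t q) (at t)"
    and F': "continuous_on UNIV (\<lambda>p. F' (fst p) (snd p))"
  shows "((\<lambda>t. \<integral>q. F t q \<partial>gegenbauer2 \<kappa>1 \<kappa>2) has_field_derivative
            (\<integral>q. F' t q \<partial>gegenbauer2 \<kappa>1 \<kappa>2)) (at t)"
proof -
  interpret finite_measure "gegenbauer2 \<kappa>1 \<kappa>2" by (rule finite_measure_gegenbauer2) fact+
  note i = integrable_gegenbauer2[OF k]
  have F'c: "continuous_on UNIV (F' t)" for t
    using continuous_on_compose2[OF F', of UNIV "\<lambda>q. (t, q)"]
    by (simp add: continuous_on_Pair continuous_on_const continuous_on_id)
  have "compact ((\<lambda>p. F' (fst p) (snd p)) ` ({t-1..t+1} \<times> ({-1..1} \<times> {-1..1})))"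
    by (intro compact_continuous_image continuous_on_subset[OF F'] compact_Times compact_square) auto
  then obtain B where B: "\<forall>p\<in>{t-1..t+1} \<times> ({-1..1} \<times> {-1..1}). norm (F' (fst p) (snd p)) \<le> B"
    by (auto dest!: compact_imp_bounded simp: bounded_iff)
  have bd: "\<bar>(F (t + h) q - F t q) / h\<bar> \<le> B" if h: "\<bar>h\<bar> \<le> 1" "h \<noteq> 0" and q: "q \<in> {-1..1} \<times> {-1..1}" for h q
  proof -
    have "\<bar>F (t + h) q - F t q\<bar> \<le> B * \<bar>t + h - t\<bar>"
      unfolding real_norm_def [symmetric]
    proof (rule field_differentiable_bound[of "{t-1..t+1}" _ "\<lambda>s. F' s q"])
      show "norm (F' z q) \<le> B" if "z \<in> {t-1..t+1}" for z
        using bspec[OF B, of "(z, q)"] that q by simp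
    qed (use h in \<open>auto intro: d has_field_derivative_at_within\<close>)
    with h show ?thesis by (simp add: field_simps abs_divide)
  qed
  have "((\<lambda>h. ((\<integral>q. F (t + h) q \<partial>gegenbauer2 \<kappa>1 \<kappa>2) - (\<integral>q. F t q \<partial>gegenbauer2 \<kappa>1 \<kappa>2)) / h)
      \<longlongrightarrow> (\<integral>q. F' t q \<partial>gegenbauer2 \<kappa>1 \<kappa>2)) (at 0 within {-1..1})"
    unfolding tendsto_at_iff_sequentially
  proof (intro allI impI)
    fix X :: "nat \<Rightarrow> real"
    assume X: "\<forall>i. X i \<in> {-1..1} - {0}" "X \<longlonglongrightarrow> 0"
    have "(\<lambda>n. \<integral>q. (F (t + X n) q - F t q) / X n \<partial>gegenbauer2 \<kappa>1 \<kappa>2) \<longlonglongrightarrow> (\<integral>q. F' t q \<partial>gegenbauer2 \<kappa>1 \<kappa>2)"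
    proof (rule integral_dominated_convergence[where w="\<lambda>_. B"])
      show "AE q in gegenbauer2 \<kappa>1 \<kappa>2. norm ((F (t + X n) q - F t q) / X n) \<le> B" for n
        using AE_gegenbauer2[OF k] by eventually_elim (use X(1)[rule_format, of n] bd[of "X n"] in \<open>simp add: abs_le_iff\<close>)
      show "AE q in gegenbauer2 \<kappa>1 \<kappa>2. (\<lambda>n. (F (t + X n) q - F t q) / X n) \<longlonglongrightarrow> F' t q"
      proof (rule AE_I2)
        fix q
        have "((\<lambda>h. (F (t + h) q - F t q) / h) \<longlongrightarrow> F' t q) (at 0)"
          using d[of q t] by (simp add: DERIV_def)
        then show "(\<lambda>n. (F (t + X n) q - F t q) / X n) \<longlonglongrightarrow> F' t q"
          using X unfolding tendsto_at_iff_sequentially by (auto simp: o_def)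
      qed
    qed (use X in \<open>auto intro!: continuous_imp_measurable_gegenbauer2 continuous_intros F F'c\<close>)
    then show "((\<lambda>h. ((\<integral>q. F (t + h) q \<partial>gegenbauer2 \<kappa>1 \<kappa>2) - (\<integral>q. F t q \<partial>gegenbauer2 \<kappa>1 \<kappa>2)) / h) \<circ> X)
        \<longlonglongrightarrow> (\<integral>q. F' t q \<partial>gegenbauer2 \<kappa>1 \<kappa>2)"
      by (simp add: o_def i F Bochner_Integration.integral_diff)
  qed
  moreover have "at (0::real) within {-1..1} = at 0"
    by (rule at_within_Icc_at) auto
  ultimately show ?thesis by (simp add: DERIV_def)
qed

section \<open>Bessel power series and analyticity of their integrals\<close>

definition bessel_coeff :: "real \<Rightarrow> nat \<Rightarrow> real" where
  "bessel_coeff b n = 1 / (8 ^ n * fact n * pochhammer b n)"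

text \<open>This is \<open>I\<^bsub>b-1\<^esub>(sqrt(z/2))\<close> as a function of \<open>z\<close>. Unlike the Bessel function of the square root it is entire in
  \<open>z\<close>, and differentiation only raises the parameter \<open>b\<close>.\<close>

definition bessel_Phi :: "real \<Rightarrow> real \<Rightarrow> real" where
  "bessel_Phi b z = (\<Sum>n. bessel_coeff b n * z ^ n)"

text \<open>The bound \<open>b \<ge> 1/2\<close> makes every factor \<open>8 (b + n)\<close> at least one. The parameters \<open>\<mu>\<close>, \<open>\<mu> + 1\<close>, \<open>\<mu> + 2\<close> that occur
  later satisfy it.\<close>

lemma bessel_coeff_bound:
  assumes "b \<ge> 1/2"
  shows "\<bar>bessel_coeff b n\<bar> \<le> 1 / fact n"
proof -
  have *: "8 ^ n * pochhammer b n \<ge> 1"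
  proof (induction n)
    case (Suc n)
    have "1 \<le> 8 ^ n * pochhammer b n * (8 * (b + real n))"
      using Suc assms mult_mono[of 1 "8 ^ n * pochhammer b n" 1 "8 * (b + real n)"] by simp
    also have "\<dots> = 8 ^ Suc n * pochhammer b (Suc n)"
      by (simp add: pochhammer_Suc algebra_simps)
    finally show ?case .
  qed simp
  have "(fact n :: real) * 1 \<le> fact n * (8 ^ n * pochhammer b n)"
    by (intro mult_left_mono *) auto
  moreover have "pochhammer b n \<ge> 0" using assms by (intro pochhammer_nonneg) auto
  ultimately show ?thesis
    unfolding bessel_coeff_def abs_divide abs_mult
    by (intro frac_le) (auto simp: mult_ac)
qed

lemma summable_exp_bounded:
  fixes c :: "nat \<Rightarrow> real"
  assumes "\<And>n. \<bar>c n\<bar> \<le> 1 / fact n"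
  shows "summable (\<lambda>n. \<bar>c n * z ^ n\<bar>)"
proof (rule summable_comparison_test)
  show "\<exists>N. \<forall>n\<ge>N. norm \<bar>c n * z ^ n\<bar> \<le> inverse (fact n) * \<bar>z\<bar> ^ n"
    using assms by (auto simp: abs_mult power_abs divide_inverse intro!: mult_right_mono)
  show "summable (\<lambda>n. inverse (fact n) * \<bar>z\<bar> ^ n)" by (rule summable_exp)
qed

lemma summable_bessel:
  assumes "b \<ge> 1/2"
  shows "summable (\<lambda>n. bessel_coeff b n * z ^ n)"
  by (rule summable_rabs_cancel[OF summable_exp_bounded[OF bessel_coeff_bound[OF assms]]])

lemma DERIV_bessel_Phi [derivative_intros]:
  assumes "b \<ge> 1/2" "(f has_field_derivative f') (at x within s)"
  shows "((\<lambda>x. bessel_Phi b (f x)) has_field_derivative (bessel_Phi (b + 1) (f x) / (8 * b) * f')) (at x within s)"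
proof (rule DERIV_chain2[OF _ assms(2)])
  have "(bessel_Phi b has_field_derivative (\<Sum>n. diffs (bessel_coeff b) n * (f x) ^ n)) (at (f x))"
    unfolding bessel_Phi_def [abs_def]
    by (rule termdiffs_strong_converges_everywhere) (rule summable_bessel[OF assms(1)])
  also have "(\<Sum>n. diffs (bessel_coeff b) n * (f x) ^ n) = (\<Sum>n. bessel_coeff (b + 1) n * (f x) ^ n / (8 * b))"
    using assms(1) by (intro suminf_cong)
      (simp add: diffs_def bessel_coeff_def pochhammer_rec divide_simps)
  also have "\<dots> = bessel_Phi (b + 1) (f x) / (8 * b)"
    unfolding bessel_Phi_def using assms(1) by (intro suminf_divide summable_bessel) simp
  finally show "(bessel_Phi b has_field_derivative bessel_Phi (b + 1) (f x) / (8 * b)) (at (f x))" .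
qed

lemma continuous_on_bessel_Phi [continuous_intros]:
  assumes "b \<ge> 1/2" "continuous_on s f"
  shows "continuous_on s (\<lambda>x. bessel_Phi b (f x))"
proof (rule continuous_on_compose2[OF _ assms(2)])
  show "continuous_on UNIV (bessel_Phi b)"
    using DERIV_bessel_Phi[OF assms(1) DERIV_ident] by (meson DERIV_isCont continuous_at_imp_continuous_on)
qed auto

text \<open>The classical three-term recurrence for modified Bessel functions, which here compares coefficients of
  \<open>z ^ Suc n\<close>.\<close>

lemma bessel_Phi_recurrence:
  assumes "b \<ge> 1/2"
  shows "bessel_Phi b z = bessel_Phi (b + 1) z + z / (8 * b * (b + 1)) * bessel_Phi (b + 2) z"
proof -
  have b: "b + 1 \<ge> 1/2" "b + 2 \<ge> 1/2" using assms by auto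
  have c: "bessel_coeff b (Suc n) = bessel_coeff (b + 1) (Suc n) + bessel_coeff (b + 2) n / (8 * b * (b + 1))" for n
  proof -
    have p: "pochhammer (b + 2) n > 0" using assms by (intro pochhammer_pos) auto
    have 1: "pochhammer b (Suc (Suc n)) = b * (b + 1) * pochhammer (b + 2) n"
      by (simp add: pochhammer_rec add.assoc)
    have 2: "pochhammer b (Suc n) = b * (b + 1) * pochhammer (b + 2) n / (b + real (Suc n))"
      using 1 assms by (simp add: pochhammer_Suc[of b "Suc n"] field_simps)
    have 3: "pochhammer (b + 1) (Suc n) = (b + 1) * pochhammer (b + 2) n"
      by (simp add: pochhammer_rec add.assoc)
    show ?thesis
      unfolding bessel_coeff_def 2 3 using assms p by (simp add: divide_simps)
  qed
  have "bessel_Phi b z = 1 + (\<Sum>n. bessel_coeff b (Suc n) * z ^ Suc n)"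
    unfolding bessel_Phi_def using suminf_split_head[OF summable_bessel[OF assms]]
    by (simp add: bessel_coeff_def)
  also have "(\<Sum>n. bessel_coeff b (Suc n) * z ^ Suc n)
     = (\<Sum>n. bessel_coeff (b + 1) (Suc n) * z ^ Suc n + z / (8 * b * (b + 1)) * (bessel_coeff (b + 2) n * z ^ n))"
    by (intro suminf_cong) (simp add: c distrib_right)
  also have "\<dots> = (\<Sum>n. bessel_coeff (b + 1) (Suc n) * z ^ Suc n)
      + (\<Sum>n. z / (8 * b * (b + 1)) * (bessel_coeff (b + 2) n * z ^ n))"
    by (intro suminf_add [symmetric] summable_mult summable_bessel b)
      (rule iffD2[OF summable_Suc_iff summable_bessel[OF b(1)]])
  also have "(\<Sum>n. z / (8 * b * (b + 1)) * (bessel_coeff (b + 2) n * z ^ n)) = z / (8 * b * (b + 1)) * bessel_Phi (b + 2) z"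
    unfolding bessel_Phi_def by (intro suminf_mult summable_bessel b)
  also have "1 + ((\<Sum>n. bessel_coeff (b + 1) (Suc n) * z ^ Suc n) + z / (8 * b * (b + 1)) * bessel_Phi (b + 2) z)
      = bessel_Phi (b + 1) z + z / (8 * b * (b + 1)) * bessel_Phi (b + 2) z"
    unfolding bessel_Phi_def [of "b + 1"] using suminf_split_head[OF summable_bessel[OF b(1)]]
    by (simp add: bessel_coeff_def)
  finally show ?thesis .
qed

lemma bessel_I_norm_eq_bessel_Phi:
  assumes "b \<ge> 1/2" "z \<ge> 0"
  shows "bessel_I_norm (b - 1) (sqrt (z / 2)) = bessel_Phi b z"
proof -
  have g: "Gamma b \<noteq> 0" using Gamma_real_pos[of b] assms(1) by (auto simp: less_le)
  let ?t = "\<lambda>m. (sqrt (z / 2) / 2) ^ (2 * m) / (fact m * Gamma (real m + (b - 1) + 1))"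
  have t: "?t m = bessel_coeff b m * z ^ m / Gamma b" for m
  proof -
    have "b \<notin> \<int>\<^sub>\<le>\<^sub>0" using assms(1) by (auto elim!: nonpos_Ints_cases)
    then have "pochhammer b m = Gamma (b + real m) / Gamma b" by (rule pochhammer_Gamma)
    moreover have "(sqrt (z / 2) / 2) ^ (2 * m) = (z / 8) ^ m"
      using assms(2) by (simp add: power_mult power_divide)
    ultimately show ?thesis using g by (simp add: bessel_coeff_def power_divide add.commute)
  qed
  have "(\<Sum>m. ?t m) = bessel_Phi b z / Gamma b"
    unfolding t bessel_Phi_def by (intro suminf_divide summable_bessel assms(1))
  then show ?thesis unfolding bessel_I_norm_def using g by simp
qed

lemma integral_gegenbauer2_bound:
  fixes h :: "real \<times> real \<Rightarrow> real"
  assumes k: "\<kappa>1 > 0" "\<kappa>2 > 0" and h: "continuous_on UNIV h"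
    and B: "\<And>q. q \<in> {-1..1} \<times> {-1..1} \<Longrightarrow> \<bar>h q\<bar> \<le> B"
  shows "\<bar>\<integral>q. h q \<partial>gegenbauer2 \<kappa>1 \<kappa>2\<bar> \<le> B * measure (gegenbauer2 \<kappa>1 \<kappa>2) UNIV"
proof -
  interpret finite_measure "gegenbauer2 \<kappa>1 \<kappa>2" by (rule finite_measure_gegenbauer2) fact+
  have sp: "space (gegenbauer2 \<kappa>1 \<kappa>2) = UNIV"
    using sets_eq_imp_space_eq[OF sets_gegenbauer2] by simp
  have "\<bar>\<integral>q. h q \<partial>gegenbauer2 \<kappa>1 \<kappa>2\<bar> \<le> (\<integral>q. \<bar>h q\<bar> \<partial>gegenbauer2 \<kappa>1 \<kappa>2)"
    by (rule integral_abs_bound)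
  also have "\<dots> \<le> (\<integral>q. B \<partial>gegenbauer2 \<kappa>1 \<kappa>2)"
  proof (rule integral_mono_AE)
    show "AE q in gegenbauer2 \<kappa>1 \<kappa>2. \<bar>h q\<bar> \<le> B"
      using AE_gegenbauer2[OF k] by eventually_elim (rule B)
  qed (auto intro!: integrable_gegenbauer2 k continuous_intros h)
  also have "\<dots> = B * measure (gegenbauer2 \<kappa>1 \<kappa>2) UNIV" by (simp add: sp)
  finally show ?thesis .
qed

text \<open>The multinomial theorem, with each coefficient replaced by the words that it counts.\<close>

lemma sum_prod_list_words:
  fixes t :: "'a \<Rightarrow> real"
  assumes "finite A"
  shows "(\<Sum>s | set s \<subseteq> A \<and> length s = n. prod_list (map t s)) = (sum t A) ^ n"
proof (induction n)
  case 0
  have "{s. set s \<subseteq> A \<and> length s = 0} = {[]}" by auto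
  then show ?case by simp
next
  case (Suc n)
  have inj: "inj_on (\<lambda>(s, a). a # s) X" for X :: "('a list \<times> 'a) set"
    by (auto simp: inj_on_def)
  show ?case
    unfolding lists_length_Suc_eq power_Suc2
    by (subst sum.reindex[OF inj])
      (simp add: o_def case_prod_unfold Suc [symmetric] sum_product sum.cartesian_product, simp only: mult.commute)
qed

text \<open>Expand the \<open>n\<close>-th power over words of length \<open>n\<close> in the monomials: inside the integral only finite sums occur
  for each \<open>n\<close>, and each word contributes one monomial in \<open>x\<close> whose coefficient is an integral. Bounding the
  integrand on the square dominates the family of all words by an exponential series, so the sum over \<open>n\<close> can
  be exchanged with the integral and the family can be regrouped.\<close>

lemma entire2_gegenbauer2_power_series:
  fixes c :: "nat \<Rightarrow> real" and coef :: "nat \<Rightarrow> real \<times> real \<Rightarrow> real" and g :: "real \<times> real \<Rightarrow> real"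
  assumes k: "\<kappa>1 > 0" "\<kappa>2 > 0"
    and c: "\<And>n. \<bar>c n\<bar> \<le> 1 / fact n"
    and coef: "\<And>l. continuous_on UNIV (coef l)" and g: "continuous_on UNIV g"
  shows "entire2 (\<lambda>x. \<integral>q. (\<Sum>n. c n * (\<Sum>l<N. coef l q * fst x ^ d l * snd x ^ e l) ^ n) * g q
            \<partial>gegenbauer2 \<kappa>1 \<kappa>2)"
proof -
  let ?Q = "gegenbauer2 \<kappa>1 \<kappa>2"
  let ?sq = "{-1..1::real} \<times> {-1..1::real}"
  note i = integrable_gegenbauer2[OF k]
  define W where "W n = {s :: nat list. set s \<subseteq> {..<N} \<and> length s = n}" for n
  have W: "finite (W n)" for n unfolding W_def by (rule finite_lists_length_eq) simp
  define \<alpha> where "\<alpha> s = c (length s) * (\<integral>q. prod_list (map (\<lambda>l. coef l q) s) * g q \<partial>?Q)" for s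
  define D E where "D s = sum_list (map d s)" and "E s = sum_list (map e s)" for s
  obtain G where G: "G \<ge> 0" "\<And>q. q \<in> ?sq \<Longrightarrow> \<bar>g q\<bar> \<le> G"
    using continuous_bounded_on_square[OF g] by blast
  have "\<exists>C. \<forall>l. 0 \<le> C l \<and> (\<forall>q\<in>?sq. \<bar>coef l q\<bar> \<le> C l)"
    by (rule choice) (metis continuous_bounded_on_square[OF coef])
  then obtain C where C: "\<And>l. 0 \<le> C l" "\<And>l q. q \<in> ?sq \<Longrightarrow> \<bar>coef l q\<bar> \<le> C l" by blast
  have cp: "continuous_on UNIV (\<lambda>q. prod_list (map (\<lambda>l. coef l q) s))" for s
    by (induction s) (auto intro!: continuous_intros coef)
  define M where "M = measure ?Q UNIV"
  have word: "prod_list (map (\<lambda>l. coef l q * a ^ d l * b ^ e l) s)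
      = prod_list (map (\<lambda>l. coef l q) s) * a ^ D s * b ^ E s" for q s a b
    by (induction s) (simp_all add: D_def E_def power_add mult_ac)
  have \<alpha>: "\<bar>\<alpha> s\<bar> * \<bar>a\<bar> ^ D s * \<bar>b\<bar> ^ E s \<le> (G * M / fact (length s)) * prod_list (map (\<lambda>l. C l * \<bar>a\<bar> ^ d l * \<bar>b\<bar> ^ e l) s)"
    for a b :: real and s
  proof -
    have "\<bar>prod_list (map (\<lambda>l. coef l q) s)\<bar> \<le> prod_list (map C s) \<and> 0 \<le> prod_list (map C s)" if "q \<in> ?sq" for q
      using that C by (induction s) (auto simp: abs_mult intro!: mult_mono)
    then have "\<bar>\<integral>q. prod_list (map (\<lambda>l. coef l q) s) * g q \<partial>?Q\<bar> \<le> prod_list (map C s) * G * M"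
      unfolding M_def by (intro integral_gegenbauer2_bound k continuous_intros cp g)
        (auto simp: abs_mult intro!: mult_mono G)
    then have "\<bar>\<alpha> s\<bar> \<le> 1 / fact (length s) * (prod_list (map C s) * G * M)"
      unfolding \<alpha>_def abs_mult by (intro mult_mono c) auto
    then have "\<bar>\<alpha> s\<bar> * (\<bar>a\<bar> ^ D s * \<bar>b\<bar> ^ E s) \<le> 1 / fact (length s) * (prod_list (map C s) * G * M) * (\<bar>a\<bar> ^ D s * \<bar>b\<bar> ^ E s)"
      by (intro mult_right_mono) auto
    also have "prod_list (map (\<lambda>l. C l * \<bar>a\<bar> ^ d l * \<bar>b\<bar> ^ e l) s) = prod_list (map C s) * \<bar>a\<bar> ^ D s * \<bar>b\<bar> ^ E s"
      by (induction s) (simp_all add: D_def E_def power_add mult_ac)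
    then have "1 / fact (length s) * (prod_list (map C s) * G * M) * (\<bar>a\<bar> ^ D s * \<bar>b\<bar> ^ E s)
       = (G * M / fact (length s)) * prod_list (map (\<lambda>l. C l * \<bar>a\<bar> ^ d l * \<bar>b\<bar> ^ e l) s)"
      by simp
    finally show ?thesis by (simp only: mult.assoc)
  qed
  show ?thesis
  proof (rule entire2_monomial_family[where \<alpha>=\<alpha> and d=D and e=E and S="{s. set s \<subseteq> {..<N}}"])
    fix a b :: real
    define Z where "Z q = (\<Sum>l<N. coef l q * a ^ d l * b ^ e l)" for q
    have cZ: "continuous_on UNIV Z" unfolding Z_def by (intro continuous_intros coef)
    obtain B where B: "B \<ge> 0" "\<And>q. q \<in> ?sq \<Longrightarrow> \<bar>Z q\<bar> \<le> B"
      using continuous_bounded_on_square[OF cZ] by blast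
    have inner: "((\<lambda>s. \<alpha> s * a ^ D s * b ^ E s) has_sum (\<integral>q. c n * Z q ^ n * g q \<partial>?Q)) (W n)" for n
    proof (rule has_sum_finiteI[OF W])
      have "(\<integral>q. c n * Z q ^ n * g q \<partial>?Q) = (\<integral>q. (\<Sum>s\<in>W n. c n * (prod_list (map (\<lambda>l. coef l q) s) * g q) * (a ^ D s * b ^ E s)) \<partial>?Q)"
        unfolding Z_def W_def
        by (subst sum_prod_list_words [symmetric], simp)
          (simp only: word sum_distrib_left sum_distrib_right, simp only: mult_ac)
      also have "\<dots> = (\<Sum>s\<in>W n. (\<integral>q. c n * (prod_list (map (\<lambda>l. coef l q) s) * g q) * (a ^ D s * b ^ E s) \<partial>?Q))"
        by (intro Bochner_Integration.integral_sum i continuous_intros cp g)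
      also have "\<dots> = (\<Sum>s\<in>W n. \<alpha> s * a ^ D s * b ^ E s)"
        by (intro sum.cong refl) (simp add: \<alpha>_def W_def)
      finally show "(\<integral>q. c n * Z q ^ n * g q \<partial>?Q) = (\<Sum>s\<in>W n. \<alpha> s * a ^ D s * b ^ E s)" .
    qed
    have "(\<lambda>(n, s). \<alpha> s * a ^ D s * b ^ E s) summable_on (Sigma UNIV W)"
    proof -
      let ?T = "\<Sum>l<N. C l * \<bar>a\<bar> ^ d l * \<bar>b\<bar> ^ e l"
      have "(\<lambda>(n, s). G * M / fact (length s) * prod_list (map (\<lambda>l. C l * \<bar>a\<bar> ^ d l * \<bar>b\<bar> ^ e l) s)) summable_on (Sigma UNIV W)"
      proof (rule summable_on_SigmaI)
        show "((\<lambda>s. case (n, s) of (n, s) \<Rightarrow> G * M / fact (length s) * prod_list (map (\<lambda>l. C l * \<bar>a\<bar> ^ d l * \<bar>b\<bar> ^ e l) s))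
           has_sum (G * M * (inverse (fact n) * ?T ^ n))) (W n)" for n
        proof (rule has_sum_finiteI[OF W])
          have "G * M * (inverse (fact n) * ?T ^ n) = (\<Sum>s\<in>W n. G * M / fact n * prod_list (map (\<lambda>l. C l * \<bar>a\<bar> ^ d l * \<bar>b\<bar> ^ e l) s))"
            unfolding W_def sum_distrib_left [symmetric] by (subst sum_prod_list_words) (auto simp: divide_inverse)
          also have "\<dots> = (\<Sum>s\<in>W n. G * M / fact (length s) * prod_list (map (\<lambda>l. C l * \<bar>a\<bar> ^ d l * \<bar>b\<bar> ^ e l) s))"
            by (intro sum.cong refl) (simp add: W_def)
          finally show "G * M * (inverse (fact n) * ?T ^ n) = (\<Sum>s\<in>W n. case (n, s) of (n, s) \<Rightarrow>
              G * M / fact (length s) * prod_list (map (\<lambda>l. C l * \<bar>a\<bar> ^ d l * \<bar>b\<bar> ^ e l) s))" by simp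
        qed
        have T: "?T \<ge> 0" using C by (intro sum_nonneg mult_nonneg_nonneg) auto
        have "summable (\<lambda>n. norm (inverse (fact n) * ?T ^ n))"
          using summable_exp[of ?T] T by simp
        then have "(\<lambda>n. inverse (fact n) * ?T ^ n) summable_on UNIV"
          by (rule norm_summable_imp_summable_on)
        then show "(\<lambda>n. G * M * (inverse (fact n) * ?T ^ n)) summable_on UNIV"
          by (rule summable_on_cmult_right)
        have "0 \<le> prod_list (map (\<lambda>l. C l * \<bar>a\<bar> ^ d l * \<bar>b\<bar> ^ e l) s)" for s
          using C by (induction s) auto
        then show "0 \<le> (case (n, s) of (n, s) \<Rightarrow> G * M / fact (length s) * prod_list (map (\<lambda>l. C l * \<bar>a\<bar> ^ d l * \<bar>b\<bar> ^ e l) s))" for n s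
          using G by (simp add: M_def)
      qed
      then have "(\<lambda>p. norm (case p of (n, s) \<Rightarrow> \<alpha> s * a ^ D s * b ^ E s)) summable_on (Sigma UNIV W)"
        by (rule summable_on_comparison_test) (use \<alpha>[of _ a b] in \<open>auto simp: abs_mult power_abs\<close>)
      then show ?thesis by (subst summable_on_iff_abs_summable_on_real)
    qed
    note summ = this
    have outer: "((\<lambda>n. \<integral>q. c n * Z q ^ n * g q \<partial>?Q) has_sum (\<integral>q. (\<Sum>n. c n * Z q ^ n) * g q \<partial>?Q)) UNIV"
    proof -
      have "(\<lambda>n. \<integral>q. c n * Z q ^ n * g q \<partial>?Q) summable_on UNIV"
        using summable_on_Sigma_banach[OF summ] infsumI[OF inner] by simp
      then have hs: "((\<lambda>n. \<integral>q. c n * Z q ^ n * g q \<partial>?Q) has_sum (\<Sum>\<^sub>\<infinity>n. \<integral>q. c n * Z q ^ n * g q \<partial>?Q)) UNIV"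
        by (rule has_sum_infsum)
      have "(\<lambda>n. \<integral>q. c n * Z q ^ n * g q \<partial>?Q) sums (\<integral>q. (\<Sum>n. c n * Z q ^ n * g q) \<partial>?Q)"
      proof (rule sums_integral)
        show "integrable ?Q (\<lambda>q. c n * Z q ^ n * g q)" for n by (intro i continuous_intros cZ g)
        show "AE q in ?Q. summable (\<lambda>n. norm (c n * Z q ^ n * g q))"
        proof (rule AE_I2)
          show "summable (\<lambda>n. norm (c n * Z q ^ n * g q))" for q
            unfolding real_norm_def abs_mult[of _ "g q"]
            by (intro summable_mult2 summable_exp_bounded c)
        qed
        have "summable (\<lambda>n. inverse (fact n) * B ^ n * (G * M))"
          by (intro summable_mult2 summable_exp)
        then show "summable (\<lambda>n. \<integral>q. norm (c n * Z q ^ n * g q) \<partial>?Q)"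
        proof (rule summable_comparison_test[rotated], intro exI allI impI)
          fix n
          have "norm (\<integral>q. norm (c n * Z q ^ n * g q) \<partial>?Q) \<le> inverse (fact n) * B ^ n * G * M"
            unfolding M_def real_norm_def
          proof (rule integral_gegenbauer2_bound[OF k])
            fix q assume "q \<in> ?sq"
            then have "\<bar>Z q\<bar> ^ n \<le> B ^ n" "\<bar>g q\<bar> \<le> G" by (auto intro: power_mono B G)
            then show "\<bar>\<bar>c n * Z q ^ n * g q\<bar>\<bar> \<le> inverse (fact n) * B ^ n * G"
              using c[of n] B G by (auto simp: abs_mult power_abs divide_inverse intro!: mult_mono)
          qed (intro continuous_intros cZ g)
          then show "norm (\<integral>q. norm (c n * Z q ^ n * g q) \<partial>?Q) \<le> inverse (fact n) * B ^ n * (G * M)" by simp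
        qed
      qed
      also have "(\<integral>q. (\<Sum>n. c n * Z q ^ n * g q) \<partial>?Q) = (\<integral>q. (\<Sum>n. c n * Z q ^ n) * g q \<partial>?Q)"
        by (intro Bochner_Integration.integral_cong refl suminf_mult2 [symmetric]
            summable_rabs_cancel[OF summable_exp_bounded[OF c]])
      finally show ?thesis using hs by (simp only: sums_unique2[OF has_sum_imp_sums[OF hs]])
    qed
    have "((\<lambda>(n, s). \<alpha> s * a ^ D s * b ^ E s) has_sum (\<integral>q. (\<Sum>n. c n * Z q ^ n) * g q \<partial>?Q)) (Sigma UNIV W)"
      by (rule has_sum_SigmaI[OF _ outer summ]) (use inner in simp)
    moreover have "Sigma UNIV W = (\<lambda>s. (length s, s)) ` {s. set s \<subseteq> {..<N}}"
      by (auto simp: W_def)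
    moreover have "inj_on (\<lambda>s. (length s, s)) {s. set s \<subseteq> {..<N}}" by (auto simp: inj_on_def)
    ultimately show "((\<lambda>s. \<alpha> s * a ^ D s * b ^ E s) has_sum
       (\<integral>q. (\<Sum>n. c n * (\<Sum>l<N. coef l q * fst (a, b) ^ d l * snd (a, b) ^ e l) ^ n) * g q \<partial>?Q)) {s. set s \<subseteq> {..<N}}"
      by (simp add: has_sum_reindex o_def Z_def)
  qed
qed

section \<open>Bessel means over the square\<close>

text \<open>\<open>Z\<close> is affine in \<open>u\<close> and in \<open>v\<close>, and at the four corners of the square it is twice a perfect square. Nonnegativity is needed because the theorem takes the square root of \<open>Z\<close>.\<close>

lemma Z_B2_nonneg:
  assumes "u \<in> {-1..1}" "v \<in> {-1..1}"
  shows "Z_B2 x y u v \<ge> 0"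
proof -
  have "2 * Z_B2 x y u v = (1 + u) * (1 + v) * (fst x * fst y + snd x * snd y)\<^sup>2
     + (1 + u) * (1 - v) * (fst x * fst y - snd x * snd y)\<^sup>2
     + (1 - u) * (1 + v) * (fst x * snd y + snd x * fst y)\<^sup>2
     + (1 - u) * (1 - v) * (fst x * snd y - snd x * fst y)\<^sup>2"
    unfolding Z_B2_def by (simp add: power2_eq_square algebra_simps)
  also have "\<dots> \<ge> 0"
  proof -
    have "0 \<le> p * r * X\<^sup>2 + p * s * X'\<^sup>2 + q * r * Y\<^sup>2 + q * s * Y'\<^sup>2"
      if "0 \<le> p" "0 \<le> q" "0 \<le> r" "0 \<le> s" for p q r s X X' Y Y' :: real
      using that by (intro add_nonneg_nonneg mult_nonneg_nonneg) auto
    then show ?thesis using assms by simp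
  qed
  finally show ?thesis by simp
qed

text \<open>Reflections of \<open>x\<close> act on the integration variables.\<close>

lemma Z_B2_reflections:
  "Z_B2 (- a, c) y u v = Z_B2 (a, c) y u (- v)" "Z_B2 (a, - c) y u v = Z_B2 (a, c) y u (- v)"
  "Z_B2 (c, a) y u v = Z_B2 (a, c) y (- u) v"
  by (simp_all add: Z_B2_def algebra_simps)

lemma continuous_on_Z_B2 [continuous_intros]:
  assumes "continuous_on S f" "continuous_on S g" "continuous_on S h"
  shows "continuous_on S (\<lambda>q. Z_B2 (f q) y (g q) (h q))"
  unfolding Z_B2_def by (intro continuous_intros assms)

lemma DERIV_Z_B2 [derivative_intros]:
  "((\<lambda>u. Z_B2 (a, c) (y1, y2) u v) has_field_derivative (a\<^sup>2 - c\<^sup>2) * (y1\<^sup>2 - y2\<^sup>2)) (at u)"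
  "((\<lambda>v. Z_B2 (a, c) (y1, y2) u v) has_field_derivative 4 * a * c * y1 * y2) (at v)"
  "((\<lambda>a. Z_B2 (a, c) (y1, y2) u v) has_field_derivative
      2 * a * (y1\<^sup>2 + y2\<^sup>2) + 2 * u * a * (y1\<^sup>2 - y2\<^sup>2) + 4 * v * c * y1 * y2) (at a)"
  "((\<lambda>c. Z_B2 (a, c) (y1, y2) u v) has_field_derivative
      2 * c * (y1\<^sup>2 + y2\<^sup>2) - 2 * u * c * (y1\<^sup>2 - y2\<^sup>2) + 4 * v * a * y1 * y2) (at c)"
  unfolding Z_B2_def by (auto intro!: derivative_eq_intros simp: algebra_simps)

definition bessel_mean ::
  "real \<Rightarrow> real \<Rightarrow> real \<times> real \<Rightarrow> real \<Rightarrow> (real \<times> real \<Rightarrow> real) \<Rightarrow> real \<times> real \<Rightarrow> real" where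
  "bessel_mean \<kappa>1 \<kappa>2 y b g x =
     (\<integral>q. bessel_Phi b (Z_B2 x y (fst q) (snd q)) * g q \<partial>gegenbauer2 \<kappa>1 \<kappa>2)"

text \<open>The polynomial factor that the kernel has besides the Gegenbauer weights.\<close>

definition kernel_weight :: "real \<times> real \<Rightarrow> real" where
  "kernel_weight q = (1 + fst q) * (1 + snd q)"

lemma continuous_on_kernel_weight [continuous_intros]:
  "continuous_on S f \<Longrightarrow> continuous_on S (\<lambda>q. kernel_weight (f q))"
  unfolding kernel_weight_def by (intro continuous_intros)

locale dunkl_B2 =
  fixes \<kappa>1 \<kappa>2 y1 y2 :: real
  assumes k: "\<kappa>1 > 0" "\<kappa>2 > 0"
begin

text \<open>
  The kernel is built from \<open>A\<close> alone. Its partial derivatives, its reflection differences and the Bessel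
  recurrence introduce no means other than \<open>A\<close>, \<open>Au\<close> and \<open>Av\<close> with a larger parameter, because \<open>Z\<close> is affine in \<open>u\<close>
  and \<open>v\<close>.
\<close>

abbreviation H where "H \<equiv> bessel_mean \<kappa>1 \<kappa>2 (y1, y2)"
abbreviation A where "A b \<equiv> H b kernel_weight"
abbreviation Au where "Au b \<equiv> H b (\<lambda>q. fst q * kernel_weight q)"
abbreviation Av where "Av b \<equiv> H b (\<lambda>q. snd q * kernel_weight q)"

lemma entire2_bessel_mean:
  assumes b: "b \<ge> 1/2" and g: "continuous_on UNIV g"
  shows "entire2 (H b g)"
proof -
  define coef where "coef = (\<lambda>(l::nat) (q::real \<times> real).
     if l = 0 then (y1\<^sup>2 + y2\<^sup>2) + fst q * (y1\<^sup>2 - y2\<^sup>2) else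
     if l = 1 then (y1\<^sup>2 + y2\<^sup>2) - fst q * (y1\<^sup>2 - y2\<^sup>2) else 4 * snd q * y1 * y2)"
  define d e :: "nat \<Rightarrow> nat" where
    "d l = (if l = 0 then 2 else if l = 1 then 0 else 1)" and
    "e l = (if l = 0 then 0 else if l = 1 then 2 else 1)" for l
  have Z: "Z_B2 x (y1, y2) (fst q) (snd q) = (\<Sum>l<3. coef l q * fst x ^ d l * snd x ^ e l)" for x q
    by (simp add: Z_B2_def coef_def d_def e_def numeral_3_eq_3 algebra_simps)
  have "continuous_on UNIV (coef l)" for l
    unfolding coef_def by (cases "l = 0"; cases "l = 1") (auto intro!: continuous_intros)
  then have "entire2 (\<lambda>x. \<integral>q. (\<Sum>n. bessel_coeff b n * (\<Sum>l<3. coef l q * fst x ^ d l * snd x ^ e l) ^ n) * g q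
            \<partial>gegenbauer2 \<kappa>1 \<kappa>2)"
    by (intro entire2_gegenbauer2_power_series k bessel_coeff_bound b g)
  then show ?thesis
    unfolding bessel_mean_def [abs_def] bessel_Phi_def Z .
qed

lemma continuous_on_bessel_mean [continuous_intros]:
  assumes "b \<ge> 1/2" "continuous_on UNIV g" "continuous_on S f"
  shows "continuous_on S (\<lambda>x. H b g (f x))"
proof (rule continuous_on_compose2[OF _ assms(3)])
  show "continuous_on UNIV (H b g)"
    by (intro continuous_at_imp_continuous_on ballI real_analytic2_isCont
        entire2_imp_real_analytic2 entire2_bessel_mean assms)
qed auto

lemma bessel_mean_integrand_continuous:
  "b \<ge> 1/2 \<Longrightarrow> continuous_on UNIV g \<Longrightarrow>
    continuous_on UNIV (\<lambda>q. bessel_Phi b (Z_B2 x y (fst q) (snd q)) * g q)"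
  by (intro continuous_intros)

lemma bessel_mean_linear:
  assumes b: "b \<ge> 1/2" and g: "continuous_on UNIV g" and h: "continuous_on UNIV h"
  shows "H b (\<lambda>q. r * g q + s * h q) x = r * H b g x + s * H b h x"
proof -
  note i = integrable_gegenbauer2[OF k bessel_mean_integrand_continuous[OF b]]
  have "H b (\<lambda>q. r * g q + s * h q) x =
     (\<integral>q. r * (bessel_Phi b (Z_B2 x (y1, y2) (fst q) (snd q)) * g q)
        + s * (bessel_Phi b (Z_B2 x (y1, y2) (fst q) (snd q)) * h q) \<partial>gegenbauer2 \<kappa>1 \<kappa>2)"
    unfolding bessel_mean_def by (simp add: algebra_simps)
  also have "\<dots> = r * H b g x + s * H b h x"
    unfolding bessel_mean_def
    by (subst Bochner_Integration.integral_add) (auto intro!: i g h)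
  finally show ?thesis .
qed

lemma bessel_mean_reflect:
  assumes b: "b \<ge> 1/2" and g: "continuous_on UNIV g"
  shows "H b g (- a, c) = H b (\<lambda>q. g (fst q, - snd q)) (a, c)"
    and "H b g (a, - c) = H b (\<lambda>q. g (fst q, - snd q)) (a, c)"
    and "H b g (c, a) = H b (\<lambda>q. g (- fst q, snd q)) (a, c)"
proof -
  have "continuous_on UNIV (\<lambda>q. bessel_Phi b (Z_B2 (a, c) (y1, y2) (fst q) (- snd q)) * g q)"
    "continuous_on UNIV (\<lambda>q. bessel_Phi b (Z_B2 (a, c) (y1, y2) (- fst q) (snd q)) * g q)"
    by (intro continuous_intros b g)+
  from integral_gegenbauer2_reflect(2)[OF k this(1)] integral_gegenbauer2_reflect(1)[OF k this(2)]
  show "H b g (- a, c) = H b (\<lambda>q. g (fst q, - snd q)) (a, c)"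
    "H b g (a, - c) = H b (\<lambda>q. g (fst q, - snd q)) (a, c)"
    "H b g (c, a) = H b (\<lambda>q. g (- fst q, snd q)) (a, c)"
    by (simp_all add: bessel_mean_def Z_B2_reflections(1,2)[of a c] Z_B2_reflections(3)[of c a])
qed

lemma continuous_kernel_weight: "continuous_on UNIV kernel_weight"
  by (rule continuous_on_kernel_weight[OF continuous_on_id])

lemma bessel_mean_affine_weight:
  assumes b: "b \<ge> 1/2"
  shows "(\<integral>q. bessel_Phi b (Z_B2 x (y1, y2) (fst q) (snd q)) * ((r + s * fst q + t * snd q) * kernel_weight q)
           \<partial>gegenbauer2 \<kappa>1 \<kappa>2) = r * A b x + s * Au b x + t * Av b x"
proof -
  note c = continuous_kernel_weight
  have "(\<integral>q. bessel_Phi b (Z_B2 x (y1, y2) (fst q) (snd q)) * ((r + s * fst q + t * snd q) * kernel_weight q)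
           \<partial>gegenbauer2 \<kappa>1 \<kappa>2)
     = H b (\<lambda>q. 1 * (r * kernel_weight q + s * (fst q * kernel_weight q)) + t * (snd q * kernel_weight q)) x"
    unfolding bessel_mean_def by (simp add: algebra_simps)
  also have "\<dots> = r * A b x + s * Au b x + t * Av b x"
    by (subst bessel_mean_linear[OF b], intro continuous_intros c, intro continuous_intros c,
        subst bessel_mean_linear[OF b], rule c, intro continuous_intros c) simp
  finally show ?thesis .
qed

text \<open>Integration by parts in \<open>v\<close>: the factor \<open>1 - v\<^sup>2\<close> it produces is \<open>(1 - v) (1 + v)\<close>, so one gets back the
  kernel weight times \<open>1 - v\<close>.\<close>

lemma bessel_mean_reflection_difference_v:
  assumes b: "b \<ge> 1/2"
  shows "\<kappa>1 * (A b (a, c) - A b (- a, c)) = a * c * y1 * y2 / (2 * b) * (A (b + 1) (a, c) - Av (b + 1) (a, c))"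
proof -
  have b1: "b + 1 \<ge> 1/2" using b by simp
  define h where "h q = bessel_Phi b (Z_B2 (a, c) (y1, y2) (fst q) (snd q)) * (1 + fst q)" for q
  define h' where "h' q = bessel_Phi (b + 1) (Z_B2 (a, c) (y1, y2) (fst q) (snd q)) / (8 * b)
      * (4 * a * c * y1 * y2) * (1 + fst q)" for q
  have ch: "continuous_on UNIV h" unfolding h_def by (intro continuous_intros b)
  have ch': "continuous_on UNIV h'" unfolding h'_def using b by (intro continuous_intros b1) auto
  have d: "((\<lambda>v. h (u, v)) has_field_derivative h' (u, v)) (at v)" for u v
    unfolding h_def h'_def by (auto intro!: derivative_eq_intros b)
  have "A b (- a, c) = (\<integral>q. h (fst q, - snd q) * (1 + snd q) \<partial>gegenbauer2 \<kappa>1 \<kappa>2)"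
    by (simp add: bessel_mean_def h_def Z_B2_reflections(1)[of a c] kernel_weight_def mult.assoc)
  moreover have "A b (a, c) = (\<integral>q. h q * (1 + snd q) \<partial>gegenbauer2 \<kappa>1 \<kappa>2)"
    by (simp add: bessel_mean_def h_def kernel_weight_def mult.assoc)
  ultimately have "A b (a, c) - A b (- a, c) = (\<integral>q. (h q - h (fst q, - snd q)) * (1 + snd q) \<partial>gegenbauer2 \<kappa>1 \<kappa>2)"
    by (simp add: left_diff_distrib Bochner_Integration.integral_diff integrable_gegenbauer2 k
        continuous_intros ch continuous_on_reflect(2)[OF ch])
  then have "\<kappa>1 * (A b (a, c) - A b (- a, c)) = (\<integral>q. (1 - (snd q)\<^sup>2) * h' q \<partial>gegenbauer2 \<kappa>1 \<kappa>2)"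
    using integral_gegenbauer2_reflection_difference(2)[OF k ch d ch'] by simp
  also have "\<dots> = (\<integral>q. a * c * y1 * y2 / (2 * b) * (bessel_Phi (b + 1) (Z_B2 (a, c) (y1, y2) (fst q) (snd q))
      * ((1 + 0 * fst q + (- 1) * snd q) * kernel_weight q)) \<partial>gegenbauer2 \<kappa>1 \<kappa>2)"
    by (intro Bochner_Integration.integral_cong refl)
      (use b in \<open>simp add: h'_def kernel_weight_def power2_eq_square divide_simps, simp add: algebra_simps\<close>)
  also have "\<dots> = a * c * y1 * y2 / (2 * b) * (A (b + 1) (a, c) - Av (b + 1) (a, c))"
    by (simp only: integral_mult_right_zero bessel_mean_affine_weight[OF b1]) simp
  finally show ?thesis .
qed

lemma bessel_mean_reflection_difference_u:
  assumes b: "b \<ge> 1/2"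
  shows "\<kappa>2 * (A b (a, c) - A b (c, a)) =
     (a\<^sup>2 - c\<^sup>2) * (y1\<^sup>2 - y2\<^sup>2) / (8 * b) * (A (b + 1) (a, c) - Au (b + 1) (a, c))"
proof -
  have b1: "b + 1 \<ge> 1/2" using b by simp
  define h where "h q = bessel_Phi b (Z_B2 (a, c) (y1, y2) (fst q) (snd q)) * (1 + snd q)" for q
  define h' where "h' q = bessel_Phi (b + 1) (Z_B2 (a, c) (y1, y2) (fst q) (snd q)) / (8 * b)
      * ((a\<^sup>2 - c\<^sup>2) * (y1\<^sup>2 - y2\<^sup>2)) * (1 + snd q)" for q
  have ch: "continuous_on UNIV h" unfolding h_def by (intro continuous_intros b)
  have ch': "continuous_on UNIV h'" unfolding h'_def using b by (intro continuous_intros b1) auto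
  have d: "((\<lambda>u. h (u, v)) has_field_derivative h' (u, v)) (at u)" for u v
    unfolding h_def h'_def by (auto intro!: derivative_eq_intros b)
  have "A b (c, a) = (\<integral>q. h (- fst q, snd q) * (1 + fst q) \<partial>gegenbauer2 \<kappa>1 \<kappa>2)"
    by (simp add: bessel_mean_def h_def Z_B2_reflections(3)[of c a] kernel_weight_def mult_ac)
  moreover have "A b (a, c) = (\<integral>q. h q * (1 + fst q) \<partial>gegenbauer2 \<kappa>1 \<kappa>2)"
    by (simp add: bessel_mean_def h_def kernel_weight_def mult_ac)
  ultimately have "A b (a, c) - A b (c, a) = (\<integral>q. (h q - h (- fst q, snd q)) * (1 + fst q) \<partial>gegenbauer2 \<kappa>1 \<kappa>2)"
    by (simp add: left_diff_distrib Bochner_Integration.integral_diff integrable_gegenbauer2 k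
        continuous_intros ch continuous_on_reflect(1)[OF ch])
  then have "\<kappa>2 * (A b (a, c) - A b (c, a)) = (\<integral>q. (1 - (fst q)\<^sup>2) * h' q \<partial>gegenbauer2 \<kappa>1 \<kappa>2)"
    using integral_gegenbauer2_reflection_difference(1)[OF k ch d ch'] by simp
  also have "\<dots> = (\<integral>q. (a\<^sup>2 - c\<^sup>2) * (y1\<^sup>2 - y2\<^sup>2) / (8 * b) * (bessel_Phi (b + 1) (Z_B2 (a, c) (y1, y2) (fst q) (snd q))
      * ((1 + (- 1) * fst q + 0 * snd q) * kernel_weight q)) \<partial>gegenbauer2 \<kappa>1 \<kappa>2)"
    by (intro Bochner_Integration.integral_cong refl)
      (use b in \<open>simp add: h'_def kernel_weight_def power2_eq_square divide_simps, simp add: algebra_simps\<close>)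
  also have "\<dots> = (a\<^sup>2 - c\<^sup>2) * (y1\<^sup>2 - y2\<^sup>2) / (8 * b) * (A (b + 1) (a, c) - Au (b + 1) (a, c))"
    by (simp only: integral_mult_right_zero bessel_mean_affine_weight[OF b1]) simp
  finally show ?thesis .
qed

text \<open>The Bessel recurrence under the integral; the factor \<open>Z\<close> that it produces is affine in \<open>u\<close> and \<open>v\<close>, so the
  three means \<open>A\<close>, \<open>Au\<close>, \<open>Av\<close> suffice to express the result.\<close>

lemma bessel_mean_recurrence:
  assumes b: "b \<ge> 1/2"
  shows "A b (a, c) = A (b + 1) (a, c) + ((a\<^sup>2 + c\<^sup>2) * (y1\<^sup>2 + y2\<^sup>2) * A (b + 2) (a, c)
     + (a\<^sup>2 - c\<^sup>2) * (y1\<^sup>2 - y2\<^sup>2) * Au (b + 2) (a, c) + 4 * a * c * y1 * y2 * Av (b + 2) (a, c))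
     / (8 * b * (b + 1))"
proof -
  have b1: "b + 1 \<ge> 1/2" "b + 2 \<ge> 1/2" using b by auto
  let ?Z = "\<lambda>q. Z_B2 (a, c) (y1, y2) (fst q) (snd q)"
  let ?I = "\<lambda>h. \<integral>q. h q \<partial>gegenbauer2 \<kappa>1 \<kappa>2"
  have "A b (a, c) = ?I (\<lambda>q. bessel_Phi (b + 1) (?Z q) * kernel_weight q
      + 1 / (8 * b * (b + 1)) * (bessel_Phi (b + 2) (?Z q) * (?Z q * kernel_weight q)))"
    unfolding bessel_mean_def bessel_Phi_recurrence[OF b]
    by (intro Bochner_Integration.integral_cong refl) (simp add: algebra_simps)
  also have "\<dots> = ?I (\<lambda>q. bessel_Phi (b + 1) (?Z q) * kernel_weight q)
      + ?I (\<lambda>q. 1 / (8 * b * (b + 1)) * (bessel_Phi (b + 2) (?Z q) * (?Z q * kernel_weight q)))"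
    using b by (intro Bochner_Integration.integral_add integrable_gegenbauer2 k continuous_intros b1) auto
  also have "?I (\<lambda>q. 1 / (8 * b * (b + 1)) * (bessel_Phi (b + 2) (?Z q) * (?Z q * kernel_weight q)))
     = 1 / (8 * b * (b + 1)) * ?I (\<lambda>q. bessel_Phi (b + 2) (?Z q) * (((a\<^sup>2 + c\<^sup>2) * (y1\<^sup>2 + y2\<^sup>2)
        + ((a\<^sup>2 - c\<^sup>2) * (y1\<^sup>2 - y2\<^sup>2)) * fst q + (4 * a * c * y1 * y2) * snd q) * kernel_weight q))"
    unfolding integral_mult_right_zero by (simp add: Z_B2_def mult_ac)
  finally show ?thesis
    unfolding bessel_mean_affine_weight[OF b1(2)] by (simp add: bessel_mean_def)
qed

lemma DERIV_bessel_mean: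
  assumes b: "b \<ge> 1/2"
  shows "((\<lambda>a. A b (a, c)) has_field_derivative
      (2 * a * (y1\<^sup>2 + y2\<^sup>2) * A (b + 1) (a, c) + 2 * a * (y1\<^sup>2 - y2\<^sup>2) * Au (b + 1) (a, c)
        + 4 * c * y1 * y2 * Av (b + 1) (a, c)) / (8 * b)) (at a)"
    and "((\<lambda>c. A b (a, c)) has_field_derivative
      (2 * c * (y1\<^sup>2 + y2\<^sup>2) * A (b + 1) (a, c) - 2 * c * (y1\<^sup>2 - y2\<^sup>2) * Au (b + 1) (a, c)
        + 4 * a * y1 * y2 * Av (b + 1) (a, c)) / (8 * b)) (at c)"
proof -
  have b1: "b + 1 \<ge> 1/2" using b by simp
  define F1 where "F1 t q = 1 / (8 * b) * (bessel_Phi (b + 1) (Z_B2 (t, c) (y1, y2) (fst q) (snd q))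
      * ((2 * t * (y1\<^sup>2 + y2\<^sup>2) + 2 * t * (y1\<^sup>2 - y2\<^sup>2) * fst q + 4 * c * y1 * y2 * snd q) * kernel_weight q))" for t q
  have "((\<lambda>t. \<integral>q. bessel_Phi b (Z_B2 (t, c) (y1, y2) (fst q) (snd q)) * kernel_weight q \<partial>gegenbauer2 \<kappa>1 \<kappa>2)
      has_field_derivative (\<integral>q. F1 a q \<partial>gegenbauer2 \<kappa>1 \<kappa>2)) (at a)"
  proof (rule has_field_derivative_integral_gegenbauer2[OF k])
    show "((\<lambda>t. bessel_Phi b (Z_B2 (t, c) (y1, y2) (fst q) (snd q)) * kernel_weight q) has_field_derivative F1 t q) (at t)" for t q
      unfolding F1_def by (auto intro!: derivative_eq_intros b simp: algebra_simps)
    show "continuous_on UNIV (\<lambda>p. F1 (fst p) (snd p))"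
      unfolding F1_def by (intro continuous_intros b1)
  qed (intro continuous_intros b)
  then show "((\<lambda>a. A b (a, c)) has_field_derivative
      (2 * a * (y1\<^sup>2 + y2\<^sup>2) * A (b + 1) (a, c) + 2 * a * (y1\<^sup>2 - y2\<^sup>2) * Au (b + 1) (a, c)
        + 4 * c * y1 * y2 * Av (b + 1) (a, c)) / (8 * b)) (at a)"
    unfolding F1_def integral_mult_right_zero bessel_mean_affine_weight[OF b1]
    by (simp add: bessel_mean_def)
  define F2 where "F2 t q = 1 / (8 * b) * (bessel_Phi (b + 1) (Z_B2 (a, t) (y1, y2) (fst q) (snd q))
      * ((2 * t * (y1\<^sup>2 + y2\<^sup>2) + (- 2 * t * (y1\<^sup>2 - y2\<^sup>2)) * fst q + 4 * a * y1 * y2 * snd q) * kernel_weight q))" for t q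
  have "((\<lambda>t. \<integral>q. bessel_Phi b (Z_B2 (a, t) (y1, y2) (fst q) (snd q)) * kernel_weight q \<partial>gegenbauer2 \<kappa>1 \<kappa>2)
      has_field_derivative (\<integral>q. F2 c q \<partial>gegenbauer2 \<kappa>1 \<kappa>2)) (at c)"
  proof (rule has_field_derivative_integral_gegenbauer2[OF k])
    show "((\<lambda>t. bessel_Phi b (Z_B2 (a, t) (y1, y2) (fst q) (snd q)) * kernel_weight q) has_field_derivative F2 t q) (at t)" for t q
      unfolding F2_def by (auto intro!: derivative_eq_intros b simp: algebra_simps)
    show "continuous_on UNIV (\<lambda>p. F2 (fst p) (snd p))"
      unfolding F2_def by (intro continuous_intros b1)
  qed (intro continuous_intros b)
  then show "((\<lambda>c. A b (a, c)) has_field_derivative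
      (2 * c * (y1\<^sup>2 + y2\<^sup>2) * A (b + 1) (a, c) - 2 * c * (y1\<^sup>2 - y2\<^sup>2) * Au (b + 1) (a, c)
        + 4 * a * y1 * y2 * Av (b + 1) (a, c)) / (8 * b)) (at c)"
    unfolding F2_def integral_mult_right_zero bessel_mean_affine_weight[OF b1]
    by (simp add: bessel_mean_def)
qed

end

section \<open>The explicit Dunkl kernel\<close>

text \<open>A continuous cofactor computes the quotient on the mirror as well, where it is defined as a limit.\<close>

lemma ext_quot_eq:
  assumes g: "\<And>z. g z = d z * q z" and q: "isCont q x" and d: "at x within {z. d z \<noteq> 0} \<noteq> bot"
  shows "ext_quot g d x = q x"
proof (cases "d x = 0")
  case True
  have "(q \<longlongrightarrow> q x) (at x within {z. d z \<noteq> 0})"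
    using q by (auto simp: isCont_def intro: tendsto_within_subset)
  then have "((\<lambda>z. g z / d z) \<longlongrightarrow> q x) (at x within {z. d z \<noteq> 0})"
    by (rule Lim_transform_eventually) (auto simp: eventually_at_filter g)
  then show ?thesis using tendsto_Lim[OF d] True by (simp add: ext_quot_def)
qed (simp add: ext_quot_def g)

lemma at_within_nonzero_linear:
  fixes d :: "real \<times> real \<Rightarrow> real"
  assumes d: "\<And>t. d (x + t *\<^sub>R e) = d x + t" and e: "norm e = 1"
  shows "at x within {z. d z \<noteq> 0} \<noteq> bot"
proof -
  have "x islimpt {z. d z \<noteq> 0}"
    unfolding islimpt_approachable
  proof (intro allI impI)
    fix r :: real assume r: "r > 0"
    obtain t where t: "0 < t" "t < r" "d x + t \<noteq> 0"
    proof (cases "d x + r / 2 = 0")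
      case True
      then show ?thesis using r by (intro that[of "r / 3"]) auto
    next
      case False
      then show ?thesis using r by (intro that[of "r / 2"]) auto
    qed
    have "e \<noteq> 0" using e by auto
    then show "\<exists>z\<in>{z. d z \<noteq> 0}. z \<noteq> x \<and> dist z x < r"
      using t e by (intro bexI[of _ "x + t *\<^sub>R e"]) (auto simp: d dist_norm)
  qed
  then show ?thesis by (simp add: trivial_limit_within)
qed

lemma at_within_off_mirror:
  fixes x :: "real \<times> real"
  shows "at x within {z. fst z \<noteq> 0} \<noteq> bot" "at x within {z. snd z \<noteq> 0} \<noteq> bot"
    "at x within {z. fst z - snd z \<noteq> 0} \<noteq> bot" "at x within {z. fst z + snd z \<noteq> 0} \<noteq> bot"
  using at_within_nonzero_linear[of fst x "(1, 0)"] at_within_nonzero_linear[of snd x "(0, 1)"]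
    at_within_nonzero_linear[of "\<lambda>z. fst z - snd z" x "(1, 0)"]
    at_within_nonzero_linear[of "\<lambda>z. fst z + snd z" x "(1, 0)"]
  by (simp_all add: norm_Pair)

text \<open>The two summands are the even and the odd part of the kernel, and the first determines the second: on odd
  functions the reflection part of the Euler identity is the scalar \<open>2 \<kappa>1 + 2 \<kappa>2\<close>, so the homogeneous component of
  degree \<open>2 n + 1\<close> is \<open>\<langle>x, y\<rangle> / (2 (n + \<mu>))\<close> times that of degree \<open>2 n\<close>. Dividing the coefficients of the Bessel
  series by \<open>n + \<mu>\<close> raises its parameter from \<open>\<mu>\<close> to \<open>\<mu> + 1\<close> and leaves the constant \<open>1 / (2 \<mu>)\<close>.\<close>

definition B2_kernel :: "real \<Rightarrow> real \<Rightarrow> real \<times> real \<Rightarrow> real \<times> real \<Rightarrow> real" where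
  "B2_kernel \<kappa>1 \<kappa>2 y x = (let \<mu> = \<kappa>1 + \<kappa>2 + 1/2 in c_B2 \<kappa>1 \<kappa>2 *
     (bessel_mean \<kappa>1 \<kappa>2 y \<mu> kernel_weight x
      + (fst x * fst y + snd x * snd y) / (2 * \<mu>) * bessel_mean \<kappa>1 \<kappa>2 y (\<mu> + 1) kernel_weight x))"

context dunkl_B2
begin

definition \<mu> :: real where "\<mu> = \<kappa>1 + \<kappa>2 + 1/2"
abbreviation "E \<equiv> B2_kernel \<kappa>1 \<kappa>2 (y1, y2)"

lemma E_eq: "E (a, c) = c_B2 \<kappa>1 \<kappa>2 * (A \<mu> (a, c) + (a * y1 + c * y2) / (2 * \<mu>) * A (\<mu> + 1) (a, c))"
  by (simp add: B2_kernel_def \<mu>_def Let_def)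

lemma mu_bounds: "\<mu> \<ge> 1/2" "\<mu> + 1 \<ge> 1/2" "\<mu> + 2 \<ge> 1/2" "\<mu> > 0"
  using k by (auto simp: \<mu>_def)

lemma E_entire2: "entire2 E"
proof -
  note e = entire2_bessel_mean[OF _ continuous_kernel_weight]
  have "entire2 (\<lambda>x. c_B2 \<kappa>1 \<kappa>2 * (A \<mu> x + (y1 / (2 * \<mu>) * (fst x * A (\<mu> + 1) x) + y2 / (2 * \<mu>) * (snd x * A (\<mu> + 1) x))))"
    by (intro entire2_cmult entire2_add entire2_mult_coordinate e mu_bounds)
  also have "(\<lambda>x. c_B2 \<kappa>1 \<kappa>2 * (A \<mu> x + (y1 / (2 * \<mu>) * (fst x * A (\<mu> + 1) x) + y2 / (2 * \<mu>) * (snd x * A (\<mu> + 1) x)))) = E"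
  proof
    fix x
    show "c_B2 \<kappa>1 \<kappa>2 * (A \<mu> x + (y1 / (2 * \<mu>) * (fst x * A (\<mu> + 1) x) + y2 / (2 * \<mu>) * (snd x * A (\<mu> + 1) x))) = E x"
      by (cases x) (simp add: E_eq add_divide_distrib algebra_simps)
  qed
  finally show ?thesis .
qed

lemma A_symmetries:
  assumes "b \<ge> 1/2"
  shows "A b (a, - c) = A b (- a, c)" "A b (- c, - a) = A b (c, a)"
  using bessel_mean_reflect(1,2)[OF assms continuous_kernel_weight]
    bessel_mean_reflect(1,2)[OF assms continuous_on_reflect(2)[OF continuous_kernel_weight], where a=c and c=a]
    bessel_mean_reflect(1,2)[OF assms continuous_kernel_weight, where a=c and c="- a"]
  by auto

text \<open>\<open>Q1\<close> and \<open>Q2\<close> are the parts of the difference quotients of the kernel that come from integration by parts in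
  \<open>v\<close> and in \<open>u\<close>; up to linear factors they are shared by the quotients of the two coordinate mirrors, respectively
  the two diagonal ones.\<close>

definition Q1 where "Q1 = (\<lambda>z. c_B2 \<kappa>1 \<kappa>2 * (y1 * y2 / (2 * \<mu>) * (A (\<mu> + 1) z - Av (\<mu> + 1) z) / \<kappa>1
   + (fst z * y1 + snd z * y2) / (2 * \<mu>) * (y1 * y2 / (2 * (\<mu> + 1)) * (A (\<mu> + 2) z - Av (\<mu> + 2) z) / \<kappa>1)))"

definition Q2 where "Q2 = (\<lambda>z. c_B2 \<kappa>1 \<kappa>2 * ((y1\<^sup>2 - y2\<^sup>2) / (8 * \<mu>) * (A (\<mu> + 1) z - Au (\<mu> + 1) z) / \<kappa>2
   + (fst z * y1 + snd z * y2) / (2 * \<mu>) * ((y1\<^sup>2 - y2\<^sup>2) / (8 * (\<mu> + 1)) * (A (\<mu> + 2) z - Au (\<mu> + 2) z) / \<kappa>2)))"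

lemma reflection_differences:
  assumes b: "b \<ge> 1/2"
  shows "A b (- a, c) = A b (a, c) - a * c * (y1 * y2 / (2 * b) * (A (b + 1) (a, c) - Av (b + 1) (a, c))) / \<kappa>1"
    and "A b (c, a) = A b (a, c) - (a\<^sup>2 - c\<^sup>2) * ((y1\<^sup>2 - y2\<^sup>2) / (8 * b) * (A (b + 1) (a, c) - Au (b + 1) (a, c))) / \<kappa>2"
proof -
  have solve: "q = p - r * s / \<kappa>" if "\<kappa> * (p - q) = t" "t = r * s" "\<kappa> > 0" for p q r s t \<kappa> :: real
    using that by (simp add: field_simps)
  show "A b (- a, c) = A b (a, c) - a * c * (y1 * y2 / (2 * b) * (A (b + 1) (a, c) - Av (b + 1) (a, c))) / \<kappa>1"
    by (rule solve[OF bessel_mean_reflection_difference_v[OF b] _ k(1)]) simp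
  show "A b (c, a) = A b (a, c) - (a\<^sup>2 - c\<^sup>2) * ((y1\<^sup>2 - y2\<^sup>2) / (8 * b) * (A (b + 1) (a, c) - Au (b + 1) (a, c))) / \<kappa>2"
    by (rule solve[OF bessel_mean_reflection_difference_u[OF b] _ k(2)]) simp
qed

text \<open>Besides the integration by parts there is a contribution of the factor \<open>\<langle>x, y\<rangle>\<close> of the odd part, whose
  reflection difference is a multiple of the linear form.\<close>

lemma E_quotients:
  "E (a, c) - E (- a, c) = a * (c * Q1 (a, c) + c_B2 \<kappa>1 \<kappa>2 * y1 / \<mu> * A (\<mu> + 1) (- a, c))"
  "E (a, c) - E (a, - c) = c * (a * Q1 (a, c) + c_B2 \<kappa>1 \<kappa>2 * y2 / \<mu> * A (\<mu> + 1) (- a, c))"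
  "E (a, c) - E (c, a) = (a - c) * ((a + c) * Q2 (a, c) + c_B2 \<kappa>1 \<kappa>2 * (y1 - y2) / (2 * \<mu>) * A (\<mu> + 1) (c, a))"
  "E (a, c) - E (- c, - a) = (a + c) * ((a - c) * Q2 (a, c) + c_B2 \<kappa>1 \<kappa>2 * (y1 + y2) / (2 * \<mu>) * A (\<mu> + 1) (c, a))"
proof -
  define R1 where "R1 = y1 * y2 / (2 * \<mu>) * (A (\<mu> + 1) (a, c) - Av (\<mu> + 1) (a, c)) / \<kappa>1"
  define R1' where "R1' = y1 * y2 / (2 * (\<mu> + 1)) * (A (\<mu> + 2) (a, c) - Av (\<mu> + 2) (a, c)) / \<kappa>1"
  define R2 where "R2 = (y1\<^sup>2 - y2\<^sup>2) / (8 * \<mu>) * (A (\<mu> + 1) (a, c) - Au (\<mu> + 1) (a, c)) / \<kappa>2"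
  define R2' where "R2' = (y1\<^sup>2 - y2\<^sup>2) / (8 * (\<mu> + 1)) * (A (\<mu> + 2) (a, c) - Au (\<mu> + 2) (a, c)) / \<kappa>2"
  have Q: "Q1 (a, c) = c_B2 \<kappa>1 \<kappa>2 * (R1 + (a * y1 + c * y2) / (2 * \<mu>) * R1')"
    "Q2 (a, c) = c_B2 \<kappa>1 \<kappa>2 * (R2 + (a * y1 + c * y2) / (2 * \<mu>) * R2')"
    unfolding Q1_def Q2_def R1_def R1'_def R2_def R2'_def fst_conv snd_conv
    by (rule refl)+
  have m2: "\<mu> + 1 + 1 = \<mu> + 2" by simp
  have r: "A \<mu> (- a, c) = A \<mu> (a, c) - a * c * R1" "A (\<mu> + 1) (a, c) = A (\<mu> + 1) (- a, c) + a * c * R1'"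
    unfolding reflection_differences(1)[OF mu_bounds(1)] reflection_differences(1)[OF mu_bounds(2)] m2 R1_def R1'_def by simp_all
  have r': "A \<mu> (c, a) = A \<mu> (a, c) - (a\<^sup>2 - c\<^sup>2) * R2" "A (\<mu> + 1) (a, c) = A (\<mu> + 1) (c, a) + (a\<^sup>2 - c\<^sup>2) * R2'"
    unfolding reflection_differences(2)[OF mu_bounds(1), where a=a and c=c] reflection_differences(2)[OF mu_bounds(2), where a=a and c=c] m2 R2_def R2'_def by simp_all
  note s = A_symmetries[OF mu_bounds(1), where a=a and c=c] A_symmetries[OF mu_bounds(2), where a=a and c=c]
  \<comment> \<open>even and odd part of one reflection difference at once; \<open>B\<close> is the mean at the reflected point\<close>
  have alg: "C * (P + w / (2 * m) * (B + t * R')) - C * ((P - t * R) + w' / (2 * m) * B)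
     = t * (C * (R + w / (2 * m) * R')) + C * (w - w') / (2 * m) * B" for C P w w' m B t R R' :: real
    by (simp add: algebra_simps diff_divide_distrib add_divide_distrib)
  have w: "a * y1 + c * y2 - (- a * y1 + c * y2) = 2 * (a * y1)" "a * y1 + c * y2 - (a * y1 + - c * y2) = 2 * (c * y2)"
    "a * y1 + c * y2 - (c * y1 + a * y2) = (a - c) * (y1 - y2)" "a * y1 + c * y2 - (- c * y1 + - a * y2) = (a + c) * (y1 + y2)"
    "a\<^sup>2 - c\<^sup>2 = (a + c) * (a - c)"
    by (simp_all add: algebra_simps power2_eq_square)
  show "E (a, c) - E (- a, c) = a * (c * Q1 (a, c) + c_B2 \<kappa>1 \<kappa>2 * y1 / \<mu> * A (\<mu> + 1) (- a, c))"
    unfolding E_eq r(1) unfolding r(2) alg Q w by (simp add: distrib_left mult_ac)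
  show "E (a, c) - E (a, - c) = c * (a * Q1 (a, c) + c_B2 \<kappa>1 \<kappa>2 * y2 / \<mu> * A (\<mu> + 1) (- a, c))"
    unfolding E_eq s r(1) unfolding r(2) alg Q w by (simp add: distrib_left mult_ac)
  show "E (a, c) - E (c, a) = (a - c) * ((a + c) * Q2 (a, c) + c_B2 \<kappa>1 \<kappa>2 * (y1 - y2) / (2 * \<mu>) * A (\<mu> + 1) (c, a))"
    unfolding E_eq r'(1) unfolding r'(2) alg Q w by (simp add: distrib_left mult_ac)
  show "E (a, c) - E (- c, - a) = (a + c) * ((a - c) * Q2 (a, c) + c_B2 \<kappa>1 \<kappa>2 * (y1 + y2) / (2 * \<mu>) * A (\<mu> + 1) (c, a))"
    unfolding E_eq s r'(1) unfolding r'(2) alg Q w by (simp add: algebra_simps)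
qed

lemma continuous_Q: "continuous_on UNIV Q1" "continuous_on UNIV Q2"
proof -
  have w: "continuous_on UNIV (\<lambda>q. fst q * kernel_weight q)" "continuous_on UNIV (\<lambda>q. snd q * kernel_weight q)"
    by (intro continuous_intros continuous_kernel_weight)+
  note A = continuous_on_bessel_mean[OF _ continuous_kernel_weight continuous_on_id]
    continuous_on_bessel_mean[OF _ w(1) continuous_on_id] continuous_on_bessel_mean[OF _ w(2) continuous_on_id]
  have nz: "2 * \<mu> \<noteq> 0" "\<kappa>1 \<noteq> 0" "\<kappa>2 \<noteq> 0" using mu_bounds(4) k by auto
  show "continuous_on UNIV Q1" "continuous_on UNIV Q2"
    unfolding Q1_def Q2_def
    by (intro continuous_on_add continuous_on_diff continuous_on_mult continuous_on_divide continuous_on_const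
        continuous_on_fst continuous_on_snd continuous_on_id A mu_bounds ballI nz)+
qed

lemma E_ext_quot:
  "ext_quot (\<lambda>z. E z - E (- fst z, snd z)) (\<lambda>z. fst z) (a, c) = c * Q1 (a, c) + c_B2 \<kappa>1 \<kappa>2 * y1 / \<mu> * A (\<mu> + 1) (- a, c)"
  "ext_quot (\<lambda>z. E z - E (fst z, - snd z)) (\<lambda>z. snd z) (a, c) = a * Q1 (a, c) + c_B2 \<kappa>1 \<kappa>2 * y2 / \<mu> * A (\<mu> + 1) (- a, c)"
  "ext_quot (\<lambda>z. E z - E (snd z, fst z)) (\<lambda>z. fst z - snd z) (a, c)
     = (a + c) * Q2 (a, c) + c_B2 \<kappa>1 \<kappa>2 * (y1 - y2) / (2 * \<mu>) * A (\<mu> + 1) (c, a)"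
  "ext_quot (\<lambda>z. E z - E (- snd z, - fst z)) (\<lambda>z. fst z + snd z) (a, c)
     = (a - c) * Q2 (a, c) + c_B2 \<kappa>1 \<kappa>2 * (y1 + y2) / (2 * \<mu>) * A (\<mu> + 1) (c, a)"
proof -
  have cont: "isCont q x" if "continuous_on UNIV q" for q :: "real \<times> real \<Rightarrow> real" and x
    using that continuous_on_eq_continuous_at[OF open_UNIV] by blast
  have c: "continuous_on UNIV (\<lambda>z. snd z * Q1 z + c_B2 \<kappa>1 \<kappa>2 * y1 / \<mu> * A (\<mu> + 1) (- fst z, snd z))"
    "continuous_on UNIV (\<lambda>z. fst z * Q1 z + c_B2 \<kappa>1 \<kappa>2 * y2 / \<mu> * A (\<mu> + 1) (- fst z, snd z))"
    "continuous_on UNIV (\<lambda>z. (fst z + snd z) * Q2 z + c_B2 \<kappa>1 \<kappa>2 * (y1 - y2) / (2 * \<mu>) * A (\<mu> + 1) (snd z, fst z))"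
    "continuous_on UNIV (\<lambda>z. (fst z - snd z) * Q2 z + c_B2 \<kappa>1 \<kappa>2 * (y1 + y2) / (2 * \<mu>) * A (\<mu> + 1) (snd z, fst z))"
    by (intro continuous_on_add continuous_on_diff continuous_on_mult continuous_on_const continuous_on_Pair
        continuous_on_minus continuous_on_fst continuous_on_snd continuous_on_id continuous_Q
        continuous_on_bessel_mean mu_bounds continuous_kernel_weight)+
  have "ext_quot (\<lambda>z. E z - E (- fst z, snd z)) (\<lambda>z. fst z) (a, c)
      = (\<lambda>z. snd z * Q1 z + c_B2 \<kappa>1 \<kappa>2 * y1 / \<mu> * A (\<mu> + 1) (- fst z, snd z)) (a, c)"
    by (rule ext_quot_eq[OF _ cont[OF c(1)] at_within_off_mirror(1)]) (auto simp: E_quotients)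
  then show "ext_quot (\<lambda>z. E z - E (- fst z, snd z)) (\<lambda>z. fst z) (a, c) = c * Q1 (a, c) + c_B2 \<kappa>1 \<kappa>2 * y1 / \<mu> * A (\<mu> + 1) (- a, c)"
    by simp
  have "ext_quot (\<lambda>z. E z - E (fst z, - snd z)) (\<lambda>z. snd z) (a, c)
      = (\<lambda>z. fst z * Q1 z + c_B2 \<kappa>1 \<kappa>2 * y2 / \<mu> * A (\<mu> + 1) (- fst z, snd z)) (a, c)"
    by (rule ext_quot_eq[OF _ cont[OF c(2)] at_within_off_mirror(2)]) (auto simp: E_quotients)
  then show "ext_quot (\<lambda>z. E z - E (fst z, - snd z)) (\<lambda>z. snd z) (a, c) = a * Q1 (a, c) + c_B2 \<kappa>1 \<kappa>2 * y2 / \<mu> * A (\<mu> + 1) (- a, c)"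
    by simp
  have "ext_quot (\<lambda>z. E z - E (snd z, fst z)) (\<lambda>z. fst z - snd z) (a, c)
      = (\<lambda>z. (fst z + snd z) * Q2 z + c_B2 \<kappa>1 \<kappa>2 * (y1 - y2) / (2 * \<mu>) * A (\<mu> + 1) (snd z, fst z)) (a, c)"
    by (rule ext_quot_eq[OF _ cont[OF c(3)] at_within_off_mirror(3)]) (auto simp: E_quotients)
  then show "ext_quot (\<lambda>z. E z - E (snd z, fst z)) (\<lambda>z. fst z - snd z) (a, c)
     = (a + c) * Q2 (a, c) + c_B2 \<kappa>1 \<kappa>2 * (y1 - y2) / (2 * \<mu>) * A (\<mu> + 1) (c, a)"
    by simp
  have "ext_quot (\<lambda>z. E z - E (- snd z, - fst z)) (\<lambda>z. fst z + snd z) (a, c)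
      = (\<lambda>z. (fst z - snd z) * Q2 z + c_B2 \<kappa>1 \<kappa>2 * (y1 + y2) / (2 * \<mu>) * A (\<mu> + 1) (snd z, fst z)) (a, c)"
    by (rule ext_quot_eq[OF _ cont[OF c(4)] at_within_off_mirror(4)]) (auto simp: E_quotients)
  then show "ext_quot (\<lambda>z. E z - E (- snd z, - fst z)) (\<lambda>z. fst z + snd z) (a, c)
     = (a - c) * Q2 (a, c) + c_B2 \<kappa>1 \<kappa>2 * (y1 + y2) / (2 * \<mu>) * A (\<mu> + 1) (c, a)"
    by simp
qed

end

text \<open>The two Dunkl equations after all integrals have been reduced to Bessel means. Here \<open>A0\<close>, \<open>A1\<close>, \<open>A2\<close> stand for the
  mean \<open>A\<close> with parameters \<open>\<mu>\<close>, \<open>\<mu> + 1\<close>, \<open>\<mu> + 2\<close>, the letters \<open>U\<close> and \<open>V\<close> for the means with an additional factor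
  \<open>u\<close> and \<open>v\<close>, and \<open>B1\<close>, \<open>B2\<close> for \<open>A1\<close> at the reflected points. The terms with \<open>U1\<close> and \<open>V1\<close> cancel, and the
  multiples of \<open>A1\<close> that carry no factor \<open>\<langle>x, y\<rangle>\<close> match because \<open>1 + 2 k1 + 2 k2 = 2 m\<close>.\<close>

lemma dunkl_kernel_algebra:
  fixes a c y1 y2 m k1 k2 A0 A1 U1 V1 A2 U2 V2 B1 B2 :: real
  assumes m: "m > 0" "m = k1 + k2 + 1/2"
    and A0: "A0 = A1 + ((a\<^sup>2 + c\<^sup>2) * (y1\<^sup>2 + y2\<^sup>2) * A2 + (a\<^sup>2 - c\<^sup>2) * (y1\<^sup>2 - y2\<^sup>2) * U2
        + 4 * a * c * y1 * y2 * V2) / (8 * m * (m + 1))"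
    and B1: "k1 * B1 = k1 * A1 - a * c * y1 * y2 / (2 * (m + 1)) * (A2 - V2)"
    and B2: "k2 * B2 = k2 * A1 - (a\<^sup>2 - c\<^sup>2) * (y1\<^sup>2 - y2\<^sup>2) / (8 * (m + 1)) * (A2 - U2)"
  shows "(2 * a * (y1\<^sup>2 + y2\<^sup>2) * A1 + 2 * a * (y1\<^sup>2 - y2\<^sup>2) * U1 + 4 * c * y1 * y2 * V1) / (8 * m)
     + y1 / (2 * m) * A1
     + (a * y1 + c * y2) / (2 * m) *
        ((2 * a * (y1\<^sup>2 + y2\<^sup>2) * A2 + 2 * a * (y1\<^sup>2 - y2\<^sup>2) * U2 + 4 * c * y1 * y2 * V2) / (8 * (m + 1)))
     + c * (y1 * y2 / (2 * m) * (A1 - V1) + (a * y1 + c * y2) / (2 * m) * (y1 * y2 / (2 * (m + 1)) * (A2 - V2)))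
     + y1 / m * (k1 * B1)
     + 2 * a * ((y1\<^sup>2 - y2\<^sup>2) / (8 * m) * (A1 - U1) + (a * y1 + c * y2) / (2 * m) * ((y1\<^sup>2 - y2\<^sup>2) / (8 * (m + 1)) * (A2 - U2)))
     + y1 / m * (k2 * B2)
     = y1 * (A0 + (a * y1 + c * y2) / (2 * m) * A1)" (is ?first)
    and "(2 * c * (y1\<^sup>2 + y2\<^sup>2) * A1 - 2 * c * (y1\<^sup>2 - y2\<^sup>2) * U1 + 4 * a * y1 * y2 * V1) / (8 * m)
     + y2 / (2 * m) * A1
     + (a * y1 + c * y2) / (2 * m) *
        ((2 * c * (y1\<^sup>2 + y2\<^sup>2) * A2 - 2 * c * (y1\<^sup>2 - y2\<^sup>2) * U2 + 4 * a * y1 * y2 * V2) / (8 * (m + 1)))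
     + a * (y1 * y2 / (2 * m) * (A1 - V1) + (a * y1 + c * y2) / (2 * m) * (y1 * y2 / (2 * (m + 1)) * (A2 - V2)))
     + y2 / m * (k1 * B1)
     + 2 * c * (- ((y1\<^sup>2 - y2\<^sup>2) / (8 * m) * (A1 - U1) + (a * y1 + c * y2) / (2 * m) * ((y1\<^sup>2 - y2\<^sup>2) / (8 * (m + 1)) * (A2 - U2))))
     + y2 / m * (k2 * B2)
     = y2 * (A0 + (a * y1 + c * y2) / (2 * m) * A1)" (is ?second)
proof -
  \<comment> \<open>reciprocals as variables turn the claim into a polynomial identity modulo \<open>8 m i = 1\<close>\<close>
  define i j where "i = 1 / (8 * m)" and "j = 1 / (8 * (m + 1))"
  have e: "x / (8 * m) = x * i" "x / (2 * m) = 4 * x * i" "x / m = 8 * x * i"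
     "x / (8 * (m + 1)) = x * j" "x / (2 * (m + 1)) = 4 * x * j" "x / (8 * m * (m + 1)) = 8 * x * i * j" for x
    using m(1) by (auto simp: i_def j_def divide_simps)
  have "m * i = 1 / 8" using m(1) by (simp add: i_def)
  then have mi: "8 * A1 * w * ((k1 + k2 + 1/2) * i) = A1 * w" for w unfolding m(2) by simp
  show ?first
    unfolding A0 B1 B2 e using mi[of y1] by (simp add: algebra_simps power2_eq_square)
  show ?second
    unfolding A0 B1 B2 e using mi[of y2] by (simp add: algebra_simps power2_eq_square)
qed

text \<open>Collects the four terms of a Dunkl operator so that the multiplicities meet the quotients and reflected values
  for which they were computed. The second operator has the same shape after exchanging the coordinates and
  changing the sign of \<open>Y\<close>.\<close>

lemma dunkl_operator_assembly:
  fixes C D X Y x z a c m k1 k2 w w1 w2 B1 B2 :: real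
  assumes "k1 * X = C * x" "k2 * Y = C * z" "w1 + w2 = 2 * w"
  shows "C * D + k1 * (c * X + C * w / m * B1) + k2 * ((a + c) * Y + C * w1 / (2 * m) * B2)
      + k2 * ((a - c) * Y + C * w2 / (2 * m) * B2)
    = C * (D + c * x + w / m * (k1 * B1) + 2 * a * z + w / m * (k2 * B2))"
proof -
  have "C * D + k1 * (c * X + C * w / m * B1) + k2 * ((a + c) * Y + C * w1 / (2 * m) * B2)
      + k2 * ((a - c) * Y + C * w2 / (2 * m) * B2)
    = C * D + c * (k1 * X) + C * (w / m * (k1 * B1)) + 2 * a * (k2 * Y) + C * ((w1 + w2) / (2 * m) * (k2 * B2))"
    by (simp add: algebra_simps add_divide_distrib)
  then show ?thesis unfolding assms by (simp add: algebra_simps)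
qed

context dunkl_B2
begin

lemma mu_add: "\<mu> + 1 + 1 = \<mu> + 2" by simp

lemma DERIV_E:
  "((\<lambda>t. E (t, c)) has_field_derivative
      c_B2 \<kappa>1 \<kappa>2 * ((2 * a * (y1\<^sup>2 + y2\<^sup>2) * A (\<mu> + 1) (a, c) + 2 * a * (y1\<^sup>2 - y2\<^sup>2) * Au (\<mu> + 1) (a, c)
        + 4 * c * y1 * y2 * Av (\<mu> + 1) (a, c)) / (8 * \<mu>)
       + y1 / (2 * \<mu>) * A (\<mu> + 1) (a, c)
       + (a * y1 + c * y2) / (2 * \<mu>) * ((2 * a * (y1\<^sup>2 + y2\<^sup>2) * A (\<mu> + 2) (a, c)
         + 2 * a * (y1\<^sup>2 - y2\<^sup>2) * Au (\<mu> + 2) (a, c) + 4 * c * y1 * y2 * Av (\<mu> + 2) (a, c)) / (8 * (\<mu> + 1))))) (at a)"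
  "((\<lambda>t. E (a, t)) has_field_derivative
      c_B2 \<kappa>1 \<kappa>2 * ((2 * c * (y1\<^sup>2 + y2\<^sup>2) * A (\<mu> + 1) (a, c) - 2 * c * (y1\<^sup>2 - y2\<^sup>2) * Au (\<mu> + 1) (a, c)
        + 4 * a * y1 * y2 * Av (\<mu> + 1) (a, c)) / (8 * \<mu>)
       + y2 / (2 * \<mu>) * A (\<mu> + 1) (a, c)
       + (a * y1 + c * y2) / (2 * \<mu>) * ((2 * c * (y1\<^sup>2 + y2\<^sup>2) * A (\<mu> + 2) (a, c)
         - 2 * c * (y1\<^sup>2 - y2\<^sup>2) * Au (\<mu> + 2) (a, c) + 4 * a * y1 * y2 * Av (\<mu> + 2) (a, c)) / (8 * (\<mu> + 1))))) (at c)"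
proof -
  have l: "((\<lambda>t. (t * y1 + c * y2) / (2 * \<mu>)) has_field_derivative y1 / (2 * \<mu>)) (at a)"
    "((\<lambda>t. (a * y1 + t * y2) / (2 * \<mu>)) has_field_derivative y2 / (2 * \<mu>)) (at c)"
    using mu_bounds(4) by (auto intro!: derivative_eq_intros simp: power2_eq_square)
  note d = DERIV_bessel_mean[OF mu_bounds(1)] DERIV_bessel_mean[OF mu_bounds(2), unfolded mu_add]
  have rearrange: "C * (P + (q + r * s)) = C * (P + q + s * r)" for C P q r s :: real
    by (simp add: algebra_simps)
  show "((\<lambda>t. E (t, c)) has_field_derivative
      c_B2 \<kappa>1 \<kappa>2 * ((2 * a * (y1\<^sup>2 + y2\<^sup>2) * A (\<mu> + 1) (a, c) + 2 * a * (y1\<^sup>2 - y2\<^sup>2) * Au (\<mu> + 1) (a, c)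
        + 4 * c * y1 * y2 * Av (\<mu> + 1) (a, c)) / (8 * \<mu>)
       + y1 / (2 * \<mu>) * A (\<mu> + 1) (a, c)
       + (a * y1 + c * y2) / (2 * \<mu>) * ((2 * a * (y1\<^sup>2 + y2\<^sup>2) * A (\<mu> + 2) (a, c)
         + 2 * a * (y1\<^sup>2 - y2\<^sup>2) * Au (\<mu> + 2) (a, c) + 4 * c * y1 * y2 * Av (\<mu> + 2) (a, c)) / (8 * (\<mu> + 1))))) (at a)"
    unfolding E_eq
    by (rule DERIV_cong[OF DERIV_cmult[OF DERIV_add[OF d(1) DERIV_mult[OF l(1) d(3)]]]]) (rule rearrange)
  show "((\<lambda>t. E (a, t)) has_field_derivative
      c_B2 \<kappa>1 \<kappa>2 * ((2 * c * (y1\<^sup>2 + y2\<^sup>2) * A (\<mu> + 1) (a, c) - 2 * c * (y1\<^sup>2 - y2\<^sup>2) * Au (\<mu> + 1) (a, c)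
        + 4 * a * y1 * y2 * Av (\<mu> + 1) (a, c)) / (8 * \<mu>)
       + y2 / (2 * \<mu>) * A (\<mu> + 1) (a, c)
       + (a * y1 + c * y2) / (2 * \<mu>) * ((2 * c * (y1\<^sup>2 + y2\<^sup>2) * A (\<mu> + 2) (a, c)
         - 2 * c * (y1\<^sup>2 - y2\<^sup>2) * Au (\<mu> + 2) (a, c) + 4 * a * y1 * y2 * Av (\<mu> + 2) (a, c)) / (8 * (\<mu> + 1))))) (at c)"
    unfolding E_eq
    by (rule DERIV_cong[OF DERIV_cmult[OF DERIV_add[OF d(2) DERIV_mult[OF l(2) d(4)]]]]) (rule rearrange)
qed

lemma kappa_Q:
  "\<kappa>1 * Q1 (a, c) = c_B2 \<kappa>1 \<kappa>2 * (y1 * y2 / (2 * \<mu>) * (A (\<mu> + 1) (a, c) - Av (\<mu> + 1) (a, c))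
   + (a * y1 + c * y2) / (2 * \<mu>) * (y1 * y2 / (2 * (\<mu> + 1)) * (A (\<mu> + 2) (a, c) - Av (\<mu> + 2) (a, c))))"
  "\<kappa>2 * Q2 (a, c) = c_B2 \<kappa>1 \<kappa>2 * ((y1\<^sup>2 - y2\<^sup>2) / (8 * \<mu>) * (A (\<mu> + 1) (a, c) - Au (\<mu> + 1) (a, c))
   + (a * y1 + c * y2) / (2 * \<mu>) * ((y1\<^sup>2 - y2\<^sup>2) / (8 * (\<mu> + 1)) * (A (\<mu> + 2) (a, c) - Au (\<mu> + 2) (a, c))))"
proof -
  have f: "\<kappa> * (C * (p / \<kappa> + s * (r / \<kappa>))) = C * (p + s * r)" if "\<kappa> > 0" for \<kappa> C p s r :: real
    using that by (simp add: field_simps)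
  show "\<kappa>1 * Q1 (a, c) = c_B2 \<kappa>1 \<kappa>2 * (y1 * y2 / (2 * \<mu>) * (A (\<mu> + 1) (a, c) - Av (\<mu> + 1) (a, c))
   + (a * y1 + c * y2) / (2 * \<mu>) * (y1 * y2 / (2 * (\<mu> + 1)) * (A (\<mu> + 2) (a, c) - Av (\<mu> + 2) (a, c))))"
    unfolding Q1_def fst_conv snd_conv by (rule f[OF k(1)])
  show "\<kappa>2 * Q2 (a, c) = c_B2 \<kappa>1 \<kappa>2 * ((y1\<^sup>2 - y2\<^sup>2) / (8 * \<mu>) * (A (\<mu> + 1) (a, c) - Au (\<mu> + 1) (a, c))
   + (a * y1 + c * y2) / (2 * \<mu>) * ((y1\<^sup>2 - y2\<^sup>2) / (8 * (\<mu> + 1)) * (A (\<mu> + 2) (a, c) - Au (\<mu> + 2) (a, c))))"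
    unfolding Q2_def fst_conv snd_conv by (rule f[OF k(2)])
qed

lemma dunkl_E:
  "dunkl_T1 \<kappa>1 \<kappa>2 E (a, c) = y1 * E (a, c)" "dunkl_T2 \<kappa>1 \<kappa>2 E (a, c) = y2 * E (a, c)"
proof -
  let ?C = "c_B2 \<kappa>1 \<kappa>2"
  have B: "\<kappa>1 * A (\<mu> + 1) (- a, c) = \<kappa>1 * A (\<mu> + 1) (a, c)
        - a * c * y1 * y2 / (2 * (\<mu> + 1)) * (A (\<mu> + 2) (a, c) - Av (\<mu> + 2) (a, c))"
    "\<kappa>2 * A (\<mu> + 1) (c, a) = \<kappa>2 * A (\<mu> + 1) (a, c)
        - (a\<^sup>2 - c\<^sup>2) * (y1\<^sup>2 - y2\<^sup>2) / (8 * (\<mu> + 1)) * (A (\<mu> + 2) (a, c) - Au (\<mu> + 2) (a, c))"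
    using bessel_mean_reflection_difference_v[OF mu_bounds(2), of a c]
      bessel_mean_reflection_difference_u[OF mu_bounds(2), of a c]
    unfolding mu_add by (simp_all add: right_diff_distrib)
  note rec = bessel_mean_recurrence[OF mu_bounds(1), of a c]
  have "dunkl_T1 \<kappa>1 \<kappa>2 E (a, c) = ?C * (y1 * (A \<mu> (a, c) + (a * y1 + c * y2) / (2 * \<mu>) * A (\<mu> + 1) (a, c)))"
    unfolding dunkl_T1_def fst_conv snd_conv DERIV_imp_deriv[OF DERIV_E(1)] E_ext_quot
    by (rule trans[OF dunkl_operator_assembly[OF kappa_Q]], simp,
        rule arg_cong[where f="(*) ?C", OF dunkl_kernel_algebra(1)[OF mu_bounds(4) \<mu>_def rec B]])
  then show "dunkl_T1 \<kappa>1 \<kappa>2 E (a, c) = y1 * E (a, c)"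
    unfolding E_eq by (simp only: mult.left_commute)
  have neg: "\<kappa>2 * - Q2 (a, c) = ?C * - ((y1\<^sup>2 - y2\<^sup>2) / (8 * \<mu>) * (A (\<mu> + 1) (a, c) - Au (\<mu> + 1) (a, c))
   + (a * y1 + c * y2) / (2 * \<mu>) * ((y1\<^sup>2 - y2\<^sup>2) / (8 * (\<mu> + 1)) * (A (\<mu> + 2) (a, c) - Au (\<mu> + 2) (a, c))))"
    unfolding mult_minus_right kappa_Q(2) ..
  \<comment> \<open>brings the second operator into the shape of the assembly lemma, with \<open>- Q2\<close> in place of \<open>Q2\<close>\<close>
  have flip: "D + r - k * ((a + c) * q + C * (y1 - y2) / m * B) + k * ((a - c) * q + s)
     = D + r + k * ((c + a) * - q + C * (y2 - y1) / m * B) + k * ((c - a) * - q + s)" for D r k q C m B s :: real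
    by (simp add: algebra_simps diff_divide_distrib)
  have "dunkl_T2 \<kappa>1 \<kappa>2 E (a, c) = ?C * (y2 * (A \<mu> (a, c) + (a * y1 + c * y2) / (2 * \<mu>) * A (\<mu> + 1) (a, c)))"
    unfolding dunkl_T2_def fst_conv snd_conv DERIV_imp_deriv[OF DERIV_E(2)] E_ext_quot flip
    by (rule trans[OF dunkl_operator_assembly[OF kappa_Q(1) neg]], simp,
        rule arg_cong[where f="(*) ?C", OF dunkl_kernel_algebra(2)[OF mu_bounds(4) \<mu>_def rec B]])
  then show "dunkl_T2 \<kappa>1 \<kappa>2 E (a, c) = y2 * E (a, c)"
    unfolding E_eq by (simp only: mult.left_commute)
qed

text \<open>Of the eight values of the odd part, opposite points cancel. The four distinct values of the even part carry
  the weights \<open>(1 \<plusminus> u) (1 \<plusminus> v)\<close>, whose sum is \<open>4\<close>.\<close>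

lemma average_E:
  "E (a, c) + E (- a, c) + E (a, - c) + E (- a, - c) + E (c, a) + E (- c, a) + E (c, - a) + E (- c, - a)
    = 8 * (c_B2 \<kappa>1 \<kappa>2 * H \<mu> (\<lambda>q. 1) (a, c))"
proof -
  have b: "\<mu> \<ge> 1/2" by (rule mu_bounds)
  note K = continuous_kernel_weight
  have sym: "A b (a, - c) = A b (- a, c)" "A b (- a, - c) = A b (a, c)"
      "A b (c, - a) = A b (- c, a)" "A b (- c, - a) = A b (c, a)" if "b \<ge> 1/2" for b
    using A_symmetries[OF that, where a=a and c=c] A_symmetries[OF that, where a=c and c=a] by simp_all
  let ?K = "\<lambda>q. kernel_weight (fst q, - snd q)"
  have c1: "continuous_on UNIV ?K" by (rule continuous_on_reflect[OF K])
  have c2: "continuous_on UNIV (\<lambda>q. kernel_weight (- fst q, snd q))" by (rule continuous_on_reflect[OF K])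
  have c3: "continuous_on UNIV (\<lambda>q. ?K (- fst q, snd q))" by (rule continuous_on_reflect[OF c1])
  have "A \<mu> (a, c) + A \<mu> (- a, c) + (A \<mu> (c, a) + A \<mu> (- c, a))
      = (1 * H \<mu> kernel_weight (a, c) + 1 * H \<mu> ?K (a, c))
      + (1 * H \<mu> (\<lambda>q. kernel_weight (- fst q, snd q)) (a, c) + 1 * H \<mu> (\<lambda>q. ?K (- fst q, snd q)) (a, c))"
    unfolding bessel_mean_reflect(1)[OF b K] bessel_mean_reflect(3)[OF b K, of c a]
      bessel_mean_reflect(3)[OF b c1, of c a] by simp
  also have "\<dots> = 1 * H \<mu> (\<lambda>q. 1 * kernel_weight q + 1 * ?K q) (a, c)
      + 1 * H \<mu> (\<lambda>q. 1 * kernel_weight (- fst q, snd q) + 1 * ?K (- fst q, snd q)) (a, c)"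
    unfolding bessel_mean_linear[OF b K c1] bessel_mean_linear[OF b c2 c3] by simp
  also have "\<dots> = H \<mu> (\<lambda>q. 1 * (1 * kernel_weight q + 1 * ?K q)
      + 1 * (1 * kernel_weight (- fst q, snd q) + 1 * ?K (- fst q, snd q))) (a, c)"
    by (rule bessel_mean_linear[OF b, symmetric]) (intro continuous_intros K c1 c2 c3)+
  also have "(\<lambda>q. 1 * (1 * kernel_weight q + 1 * ?K q)
      + 1 * (1 * kernel_weight (- fst q, snd q) + 1 * ?K (- fst q, snd q))) = (\<lambda>q. 4 * 1 + 0 * 1)"
    by (auto simp: kernel_weight_def algebra_simps)
  also have "H \<mu> (\<lambda>q. 4 * 1 + 0 * 1) (a, c) = 4 * H \<mu> (\<lambda>q. 1) (a, c)"
    unfolding bessel_mean_linear[OF b continuous_on_const continuous_on_const] by simp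
  finally have avg: "A \<mu> (a, c) + A \<mu> (- a, c) + (A \<mu> (c, a) + A \<mu> (- c, a)) = 4 * H \<mu> (\<lambda>q. 1) (a, c)" .
  have "E (a, c) + E (- a, c) + E (a, - c) + E (- a, - c) + E (c, a) + E (- c, a) + E (c, - a) + E (- c, - a)
    = 2 * c_B2 \<kappa>1 \<kappa>2 * (A \<mu> (a, c) + A \<mu> (- a, c) + (A \<mu> (c, a) + A \<mu> (- c, a)))"
    unfolding E_eq sym[OF mu_bounds(1)] sym[OF mu_bounds(2)] by (simp add: algebra_simps add_divide_distrib diff_divide_distrib)
  then show ?thesis unfolding avg by simp
qed

text \<open>The normalisation at the origin uses the averaging identity there, since all eight points coincide.\<close>

lemma is_dunkl_kernel_E: "is_dunkl_kernel \<kappa>1 \<kappa>2 (y1, y2) E"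
  unfolding is_dunkl_kernel_def
proof (intro conjI allI)
  show "real_analytic2 E" by (rule entire2_imp_real_analytic2[OF E_entire2])
  show "dunkl_T1 \<kappa>1 \<kappa>2 E x = fst (y1, y2) * E x" "dunkl_T2 \<kappa>1 \<kappa>2 E x = snd (y1, y2) * E x" for x
    by (cases x; simp add: dunkl_E)+
  have "bessel_Phi b 0 = 1" for b
    unfolding bessel_Phi_def powser_zero by (simp add: bessel_coeff_def)
  then have "H \<mu> (\<lambda>q. 1) (0, 0) = (\<integral>q. 1 \<partial>gegenbauer2 \<kappa>1 \<kappa>2)"
    by (simp add: bessel_mean_def Z_B2_def)
  then have "c_B2 \<kappa>1 \<kappa>2 * H \<mu> (\<lambda>q. 1) (0, 0) = 1"
    using integral_const_gegenbauer2[OF k] by simp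
  then show "E (0, 0) = 1" using average_E[of 0 0] by simp
qed

end

text \<open>The signed permutations: the first two flags are the signs of the resulting coordinates, the third is the
  exchange.\<close>

definition weyl_act :: "bool \<times> bool \<times> bool \<Rightarrow> real \<times> real \<Rightarrow> real \<times> real" where
  "weyl_act = (\<lambda>(p, q, r) x. ((if p then -1 else 1) * (if r then snd x else fst x),
                              (if q then -1 else 1) * (if r then fst x else snd x)))"

lemma weyl_B2_eq: "weyl_B2 = range weyl_act"
proof (intro subset_antisym subsetI)
  fix w assume "w \<in> weyl_B2"
  then show "w \<in> range weyl_act"
  proof induction
    case weyl_id
    show ?case by (rule range_eqI[of _ _ "(False, False, False)"]) (simp add: weyl_act_def)
  next
    case (weyl_sign1 w)
    then obtain p q r where "w = weyl_act (p, q, r)" by auto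
    then show ?case by (intro range_eqI[of _ _ "(\<not> p, q, r)"]) (auto simp: weyl_act_def)
  next
    case (weyl_sign2 w)
    then obtain p q r where "w = weyl_act (p, q, r)" by auto
    then show ?case by (intro range_eqI[of _ _ "(p, \<not> q, r)"]) (auto simp: weyl_act_def)
  next
    case (weyl_swap w)
    then obtain p q r where "w = weyl_act (p, q, r)" by auto
    then show ?case by (intro range_eqI[of _ _ "(q, p, \<not> r)"]) (auto simp: weyl_act_def)
  qed
next
  fix w assume "w \<in> range weyl_act"
  then obtain p q r where w: "w = weyl_act (p, q, r)" by auto
  define w0 where "w0 = weyl_act (False, False, r)"
  have 0: "w0 \<in> weyl_B2"
    using weyl_B2.weyl_id weyl_B2.weyl_swap[OF weyl_B2.weyl_id] by (cases r) (simp_all add: w0_def weyl_act_def)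
  have 1: "weyl_act (p, False, r) \<in> weyl_B2"
    using 0 weyl_B2.weyl_sign1[OF 0] by (cases p) (simp_all add: w0_def weyl_act_def)
  show "w \<in> weyl_B2"
    unfolding w using 1 weyl_B2.weyl_sign2[OF 1] by (cases q) (simp_all add: weyl_act_def)
qed

text \<open>The point \<open>(1, 2)\<close> has trivial stabiliser.\<close>

lemma inj_weyl_act: "inj weyl_act"
proof (rule injI)
  fix s t assume "weyl_act s = weyl_act t"
  then have "weyl_act s (1, 2) = weyl_act t (1, 2)" by simp
  then show "s = t"
    by (cases s; cases t) (auto simp: weyl_act_def split: if_splits)
qed

lemma card_weyl_B2: "card weyl_B2 = 8"
  unfolding weyl_B2_eq card_image[OF inj_weyl_act] by (simp add: card_UNIV_bool card_prod)

lemma sum_weyl_B2: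
  fixes f :: "real \<times> real \<Rightarrow> real"
  shows "(\<Sum>w\<in>weyl_B2. f (w (a, c))) =
    f (a, c) + f (- a, c) + f (a, - c) + f (- a, - c) + f (c, a) + f (- c, a) + f (c, - a) + f (- c, - a)"
proof -
  have U: "(UNIV :: (bool \<times> bool \<times> bool) set) = {(False, False, False), (True, False, False), (False, True, False), (True, True, False),
    (False, False, True), (True, False, True), (False, True, True), (True, True, True)}" by auto
  show ?thesis
    unfolding weyl_B2_eq sum.reindex[OF inj_weyl_act] o_def
    unfolding U by (simp add: weyl_act_def)
qed


lemma dunkl_kernel_eq:
  assumes "\<kappa>1 > 0" "\<kappa>2 > 0"
  shows "dunkl_kernel \<kappa>1 \<kappa>2 x y = B2_kernel \<kappa>1 \<kappa>2 y x"
proof -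
  interpret dunkl_B2 \<kappa>1 \<kappa>2 "fst y" "snd y" by unfold_locales (use assms in auto)
  have K: "is_dunkl_kernel \<kappa>1 \<kappa>2 y (B2_kernel \<kappa>1 \<kappa>2 y)" using is_dunkl_kernel_E by simp
  have "(THE f. is_dunkl_kernel \<kappa>1 \<kappa>2 y f) = B2_kernel \<kappa>1 \<kappa>2 y"
    by (rule the_equality, rule K, rule is_dunkl_kernel_unique[OF _ _ _ K]) (use assms in auto)
  then show ?thesis by (simp add: dunkl_kernel_def)
qed

lemma gen_bessel_B2_eq_bessel_mean:
  assumes "\<kappa>1 > 0" "\<kappa>2 > 0"
  shows "gen_bessel_B2 \<kappa>1 \<kappa>2 x y = c_B2 \<kappa>1 \<kappa>2 * bessel_mean \<kappa>1 \<kappa>2 y (\<kappa>1 + \<kappa>2 + 1/2) (\<lambda>q. 1) x"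
proof -
  interpret dunkl_B2 \<kappa>1 \<kappa>2 "fst y" "snd y" by unfold_locales (use assms in auto)
  show ?thesis
    unfolding gen_bessel_B2_def dunkl_kernel_eq[OF assms] card_weyl_B2
    using sum_weyl_B2[of "B2_kernel \<kappa>1 \<kappa>2 y" "fst x" "snd x"] average_E[of "fst x" "snd x"]
    by (simp add: \<mu>_def)
qed

lemma bessel_mean_one_eq_double_integral:
  assumes k: "\<kappa>1 > 0" "\<kappa>2 > 0" and b: "b \<ge> 1/2"
  shows "bessel_mean \<kappa>1 \<kappa>2 y b (\<lambda>q. 1) x = (LBINT v:{-1..1}. (LBINT u:{-1..1}.
          bessel_I_norm (b - 1) (sqrt (Z_B2 x y u v / 2))
            * (1 - u\<^sup>2) powr (\<kappa>2 - 1) * (1 - v\<^sup>2) powr (\<kappa>1 - 1)))"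
proof -
  define h where "h q = bessel_Phi b (Z_B2 x y (fst q) (snd q))" for q
  have ch: "continuous_on UNIV h" unfolding h_def by (intro continuous_intros b)
  note [measurable] = borel_measurable_continuous_onI[OF ch]
  interpret finite_measure "gegenbauer \<kappa>2" by (rule finite_measure_gegenbauer[OF k(2)])
  have m: "(\<lambda>v. \<integral>u. h (u, v) \<partial>gegenbauer \<kappa>2) \<in> borel_measurable borel"
    by (rule borel_measurable_lebesgue_integral) measurable
  have "bessel_mean \<kappa>1 \<kappa>2 y b (\<lambda>q. 1) x = (\<integral>q. h q \<partial>gegenbauer2 \<kappa>1 \<kappa>2)"
    by (simp add: bessel_mean_def h_def)
  also have "\<dots> = (\<integral>v. (\<integral>u. h (u, v) \<partial>gegenbauer \<kappa>2) \<partial>gegenbauer \<kappa>1)"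
    by (rule integral_gegenbauer2_iterated(1)[OF k ch])
  also have "\<dots> = (LBINT v:{-1..1}. (\<integral>u. h (u, v) \<partial>gegenbauer \<kappa>2) * (1 - v\<^sup>2) powr (\<kappa>1 - 1))"
    by (rule integral_gegenbauer[OF m])
  also have "\<dots> = (LBINT v:{-1..1}. (LBINT u:{-1..1}. h (u, v) * (1 - u\<^sup>2) powr (\<kappa>2 - 1)) * (1 - v\<^sup>2) powr (\<kappa>1 - 1))"
    using continuous_on_section(1)[OF ch]
    by (simp add: integral_gegenbauer borel_measurable_continuous_onI)
  also have "\<dots> = (LBINT v:{-1..1}. (LBINT u:{-1..1}. h (u, v) * (1 - u\<^sup>2) powr (\<kappa>2 - 1) * (1 - v\<^sup>2) powr (\<kappa>1 - 1)))"
    by (simp only: set_integral_mult_left)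
  also have "\<dots> = (LBINT v:{-1..1}. (LBINT u:{-1..1}.
          bessel_I_norm (b - 1) (sqrt (Z_B2 x y u v / 2))
            * (1 - u\<^sup>2) powr (\<kappa>2 - 1) * (1 - v\<^sup>2) powr (\<kappa>1 - 1)))"
    by (intro set_lebesgue_integral_cong ballI allI impI)
      (auto simp: h_def bessel_I_norm_eq_bessel_Phi[OF b Z_B2_nonneg])
  finally show ?thesis .
qed

theorem theorem3p3:
  fixes \<kappa>1 \<kappa>2 :: real and x y :: "real \<times> real"
  assumes "\<kappa>1 > 0" and "\<kappa>2 > 0"
  shows "gen_bessel_B2 \<kappa>1 \<kappa>2 x y =
    (let \<mu> = \<kappa>1 + \<kappa>2 + 1 / 2 in
     c_B2 \<kappa>1 \<kappa>2 *
       (LBINT v:{-1..1}. (LBINT u:{-1..1}.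
          bessel_I_norm (\<mu> - 1) (sqrt (Z_B2 x y u v / 2))
            * (1 - u\<^sup>2) powr (\<kappa>2 - 1) * (1 - v\<^sup>2) powr (\<kappa>1 - 1))))"
  unfolding Let_def gen_bessel_B2_eq_bessel_mean[OF assms]
  by (subst bessel_mean_one_eq_double_integral[OF assms]) (use assms in auto)

end
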